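(* Let the system $\Delta^\alpha\equiv U^\alpha_{xy}+G^\alpha_{\beta\gamma}U^\beta_xU^\gamma_y=0$ ($\alpha=1,\dots,n$) admit a matrix $\mathfrak g$-valued Lax representation with functions $A_\alpha,B_\alpha,M,N$ and characteristic element $S_\alpha=A_\alpha-B_\alpha$, as defined in the context. Then for every $p\ge2$ and every symmetric ad-invariant $p$-form $f$ on the Lie algebra $\mathfrak g$ the set $$Y_\alpha=f([S_\alpha,M],[S_\beta,M],\underbrace{M,M,\dots,M}_{p-2})\,U^\beta_x,\qquad \alpha=1,\dots,n,$$ forms a cosymmetry of the first order of this system; that is, $\{Y_\alpha\}$ is the characteristic of a conservation law of the system $\Delta^\alpha=0$.
   Context: Greek indices range over $1,\dots,n$; repeated indices are summed. $x,y$ are the independent variables, $U^1,\dots,U^n$ the dependent variables; subscripts $x,y$ denote partial derivatives, and $D_x,D_y$ are total derivatives. The coefficients $G^\alpha_{\beta\gamma}$ (not assumed symmetric in $\beta,\gamma$) are smooth functions of $U=(U^1,\dots,U^n)$. Lax representation: $\mathfrak g$ is a (finite-dimensional) matrix Lie algebra, $A_\alpha,B_\alpha$ ($\alpha=1,\dots,n$), $M,N$ are smooth $\mathfrak g$-valued functions of $U^1,\dots,U^n$, and with $$\widetilde A=A_\alpha U^\alpha_x+\lambda M,\qquad \widetilde B=B_\alpha U^\alpha_y+\tfrac1\lambda N,\qquad S_\alpha=A_\alpha-B_\alpha,$$ the identity $D_y\widetilde A-D_x\widetilde B+[\widetilde A,\widetilde B]=S_\alpha\Delta^\alpha$ holds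 identically in the parameter $\lambda\neq0$ and in the variables $U^\alpha$ and their derivatives. $S_1,\dots,S_n$ (the characteristic element) are assumed linearly independent. A set of functions $R=\{R_\alpha\}$ (of $U$ and its derivatives) is the characteristic of a conservation law, also called a cosymmetry, of the system if there is a pair $L=(L_1,L_2)$ of smooth functions of $U$ and its derivatives such that $D_xL_1+D_yL_2=R_\alpha\Delta^\alpha$ holds identically (in the jet variables). It is of first order if the $R_\alpha$ depend only on $U$ and its first derivatives. A symmetric $p$-form $f$ on $\mathfrak g$ is a symmetric $p$-linear scalar-valued form; it is ad-invariant if $\sum_{i=1}^p f(X_1,\dots,[Y,X_i],\dots,X_p)=0$ for all $Y,X_1,\dots,X_p\in\mathfrak g$. *)

theory Defs
  imports "HOL-Analysis.Analysis" "HOL-Library.Groups_Big_Fun"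
begin

section \<open>Smooth functions of real coordinates\<close>

text \<open>
  Coordinates are indexed by an arbitrary type, so that the same notions apply to functions of
  \<open>U\<^sup>1, \<dots>, U\<^sup>n\<close> and to functions on the infinite jet space.
\<close>

definition partial_deriv :: "'i \<Rightarrow> (('i \<Rightarrow> real) \<Rightarrow> 'v) \<Rightarrow> ('i \<Rightarrow> real) \<Rightarrow> 'v::real_normed_vector"
  where "partial_deriv i F z = vector_derivative (\<lambda>t. F (z(i := t))) (at (z i))"

text \<open>
  All iterated partial derivatives exist and are continuous (with respect to the product
  topology). This is meant for open \<open>D\<close> and, when there are infinitely many coordinates, for
  functions that depend on finitely many of them.
\<close>

definition smooth_on :: "('i \<Rightarrow> real) set \<Rightarrow> (('i \<Rightarrow> real) \<Rightarrow> 'v::real_normed_vector) \<Rightarrow> bool"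
  where "smooth_on D F \<longleftrightarrow>
    (\<forall>is. continuous_on D (foldr partial_deriv is F) \<and>
      (\<forall>i. \<forall>z\<in>D. (\<lambda>t. foldr partial_deriv is F (z(i := t))) differentiable at (z i)))"


section \<open>Jets\<close>

text \<open>
  The jet variable \<open>(i, j, \<alpha>)\<close> is the derivative of \<open>U\<^sup>\<alpha>\<close>, \<open>i\<close> times with respect to \<open>x\<close> and
  \<open>j\<close> times with respect to \<open>y\<close>.
\<close>

type_synonym 'n jet_var = "nat \<times> nat \<times> 'n"
type_synonym 'n jet = "'n jet_var \<Rightarrow> real"

definition base :: "'n jet \<Rightarrow> 'n \<Rightarrow> real"
  where "base z = (\<lambda>\<alpha>. z (0, 0, \<alpha>))"

definition Ux :: "'n \<Rightarrow> 'n jet \<Rightarrow> real"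
  where "Ux \<alpha> z = z (1, 0, \<alpha>)"

definition Uy :: "'n \<Rightarrow> 'n jet \<Rightarrow> real"
  where "Uy \<alpha> z = z (0, 1, \<alpha>)"

definition Uxy :: "'n \<Rightarrow> 'n jet \<Rightarrow> real"
  where "Uxy \<alpha> z = z (1, 1, \<alpha>)"

definition jet_domain :: "('n \<Rightarrow> real) set \<Rightarrow> 'n jet set"
  where "jet_domain \<Omega> = {z. base z \<in> \<Omega>}"

definition depends_up_to_order :: "nat \<Rightarrow> ('n \<Rightarrow> real) set \<Rightarrow> ('n jet \<Rightarrow> 'v) \<Rightarrow> bool"
  where "depends_up_to_order k \<Omega> F \<longleftrightarrow>
    (\<forall>z\<in>jet_domain \<Omega>. \<forall>w\<in>jet_domain \<Omega>.
      (\<forall>i j \<alpha>. i + j \<le> k \<longrightarrow> z (i, j, \<alpha>) = w (i, j, \<alpha>)) \<longrightarrow> F z = F w)"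

definition differential_function :: "('n \<Rightarrow> real) set \<Rightarrow> ('n jet \<Rightarrow> 'v::real_normed_vector) \<Rightarrow> bool"
  where "differential_function \<Omega> F \<longleftrightarrow>
    smooth_on (jet_domain \<Omega>) F \<and> (\<exists>k. depends_up_to_order k \<Omega> F)"

text \<open>
  \<^const>\<open>Sum_any\<close> sums over the (finite, for differential functions) set of jet variables whose
  summand is nonzero.
\<close>

definition total_x :: "('n jet \<Rightarrow> 'v::real_normed_vector) \<Rightarrow> 'n jet \<Rightarrow> 'v"
  where "total_x F z = Sum_any (\<lambda>(i, j, \<alpha>). z (Suc i, j, \<alpha>) *\<^sub>R partial_deriv (i, j, \<alpha>) F z)"

definition total_y :: "('n jet \<Rightarrow> 'v::real_normed_vector) \<Rightarrow> 'n jet \<Rightarrow> 'v"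
  where "total_y F z = Sum_any (\<lambda>(i, j, \<alpha>). z (i, Suc j, \<alpha>) *\<^sub>R partial_deriv (i, j, \<alpha>) F z)"


section \<open>The system and its cosymmetries\<close>

definition Delta :: "('n::finite \<Rightarrow> 'n \<Rightarrow> 'n \<Rightarrow> ('n \<Rightarrow> real) \<Rightarrow> real) \<Rightarrow> 'n \<Rightarrow> 'n jet \<Rightarrow> real"
  where "Delta G \<alpha> z = Uxy \<alpha> z + (\<Sum>\<beta>\<in>UNIV. \<Sum>\<gamma>\<in>UNIV. G \<alpha> \<beta> \<gamma> (base z) * Ux \<beta> z * Uy \<gamma> z)"

definition cosymmetry ::
  "('n::finite \<Rightarrow> real) set \<Rightarrow> ('n \<Rightarrow> 'n \<Rightarrow> 'n \<Rightarrow> ('n \<Rightarrow> real) \<Rightarrow> real)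
    \<Rightarrow> ('n \<Rightarrow> 'n jet \<Rightarrow> 's::real_normed_vector) \<Rightarrow> bool"
  where "cosymmetry \<Omega> G R \<longleftrightarrow>
    (\<forall>\<alpha>. differential_function \<Omega> (R \<alpha>)) \<and>
    (\<exists>L1 L2 :: 'n jet \<Rightarrow> 's. differential_function \<Omega> L1 \<and> differential_function \<Omega> L2 \<and>
      (\<forall>z\<in>jet_domain \<Omega>. total_x L1 z + total_y L2 z = (\<Sum>\<alpha>\<in>UNIV. Delta G \<alpha> z *\<^sub>R R \<alpha> z)))"

definition first_order_cosymmetry ::
  "('n::finite \<Rightarrow> real) set \<Rightarrow> ('n \<Rightarrow> 'n \<Rightarrow> 'n \<Rightarrow> ('n \<Rightarrow> real) \<Rightarrow> real)
    \<Rightarrow> ('n \<Rightarrow> 'n jet \<Rightarrow> 's::real_normed_vector) \<Rightarrow> bool"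
  where "first_order_cosymmetry \<Omega> G R \<longleftrightarrow>
    cosymmetry \<Omega> G R \<and> (\<forall>\<alpha>. depends_up_to_order 1 \<Omega> (R \<alpha>))"


section \<open>Matrix Lie algebras and invariant forms\<close>

text \<open>
  The entries lie in a real normed field, that is, in the real or the complex numbers. A matrix
  Lie algebra is a real-linear space of matrices closed under commutators; this includes the
  complex-linear ones.
\<close>

definition bracket :: "'k::comm_ring_1 ^ 'm ^ 'm \<Rightarrow> 'k ^ 'm ^ 'm \<Rightarrow> 'k ^ 'm ^ 'm"
  where "bracket X Y = X ** Y - Y ** X"

definition matrix_lie_algebra :: "('k::real_normed_field ^ 'm ^ 'm) set \<Rightarrow> bool"
  where "matrix_lie_algebra \<gg> \<longleftrightarrow> subspace \<gg> \<and> (\<forall>X\<in>\<gg>. \<forall>Y\<in>\<gg>. bracket X Y \<in> \<gg>)"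

text \<open>
  A \<open>p\<close>-form on \<open>\<gg>\<close> is a function on lists; only its values on lists of length \<open>p\<close> with
  entries in \<open>\<gg>\<close> matter.
\<close>

definition symmetric_form :: "'a::real_vector set \<Rightarrow> nat \<Rightarrow> ('a list \<Rightarrow> 's::real_vector) \<Rightarrow> bool"
  where "symmetric_form \<gg> p f \<longleftrightarrow>
    (\<forall>Xs. length Xs = p \<and> set Xs \<subseteq> \<gg> \<longrightarrow>
      (\<forall>i<p. \<forall>X\<in>\<gg>. \<forall>Y\<in>\<gg>. \<forall>a b.
        f (Xs[i := a *\<^sub>R X + b *\<^sub>R Y]) = a *\<^sub>R f (Xs[i := X]) + b *\<^sub>R f (Xs[i := Y])) \<and>
      (\<forall>Ys. mset Ys = mset Xs \<longrightarrow> f Ys = f Xs))"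

definition ad_invariant ::
  "('k::real_normed_field ^ 'm ^ 'm) set \<Rightarrow> nat \<Rightarrow> (('k ^ 'm ^ 'm) list \<Rightarrow> 's::real_vector) \<Rightarrow> bool"
  where "ad_invariant \<gg> p f \<longleftrightarrow>
    (\<forall>Y\<in>\<gg>. \<forall>Xs. length Xs = p \<and> set Xs \<subseteq> \<gg> \<longrightarrow> (\<Sum>i<p. f (Xs[i := bracket Y (Xs ! i)])) = 0)"


section \<open>Lax representations\<close>

definition lax_x ::
  "('n::finite \<Rightarrow> ('n \<Rightarrow> real) \<Rightarrow> 'v::real_vector) \<Rightarrow> (('n \<Rightarrow> real) \<Rightarrow> 'v) \<Rightarrow> real \<Rightarrow> 'n jet \<Rightarrow> 'v"
  where "lax_x A M l z = (\<Sum>\<alpha>\<in>UNIV. Ux \<alpha> z *\<^sub>R A \<alpha> (base z)) + l *\<^sub>R M (base z)"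

definition lax_y ::
  "('n::finite \<Rightarrow> ('n \<Rightarrow> real) \<Rightarrow> 'v::real_vector) \<Rightarrow> (('n \<Rightarrow> real) \<Rightarrow> 'v) \<Rightarrow> real \<Rightarrow> 'n jet \<Rightarrow> 'v"
  where "lax_y B N l z = (\<Sum>\<alpha>\<in>UNIV. Uy \<alpha> z *\<^sub>R B \<alpha> (base z)) + (1 / l) *\<^sub>R N (base z)"

definition char_elem ::
  "('n \<Rightarrow> ('n \<Rightarrow> real) \<Rightarrow> 'v::real_vector) \<Rightarrow> ('n \<Rightarrow> ('n \<Rightarrow> real) \<Rightarrow> 'v) \<Rightarrow> 'n \<Rightarrow> ('n \<Rightarrow> real) \<Rightarrow> 'v"
  where "char_elem A B \<alpha> u = A \<alpha> u - B \<alpha> u"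

text \<open>
  Linear independence of the characteristic element is required at every point of \<open>\<Omega>\<close>, so that
  the zero-curvature condition is equivalent to the system.
\<close>

definition lax_representation ::
  "('n::finite \<Rightarrow> real) set \<Rightarrow> ('n \<Rightarrow> 'n \<Rightarrow> 'n \<Rightarrow> ('n \<Rightarrow> real) \<Rightarrow> real)
    \<Rightarrow> ('k::real_normed_field ^ 'm ^ 'm) set
    \<Rightarrow> ('n \<Rightarrow> ('n \<Rightarrow> real) \<Rightarrow> 'k ^ 'm ^ 'm) \<Rightarrow> ('n \<Rightarrow> ('n \<Rightarrow> real) \<Rightarrow> 'k ^ 'm ^ 'm)
    \<Rightarrow> (('n \<Rightarrow> real) \<Rightarrow> 'k ^ 'm ^ 'm) \<Rightarrow> (('n \<Rightarrow> real) \<Rightarrow> 'k ^ 'm ^ 'm) \<Rightarrow> bool"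
  where "lax_representation \<Omega> G \<gg> A B M N \<longleftrightarrow>
    (\<forall>\<alpha>. smooth_on \<Omega> (A \<alpha>) \<and> A \<alpha> ` \<Omega> \<subseteq> \<gg>) \<and> (\<forall>\<alpha>. smooth_on \<Omega> (B \<alpha>) \<and> B \<alpha> ` \<Omega> \<subseteq> \<gg>) \<and>
    smooth_on \<Omega> M \<and> M ` \<Omega> \<subseteq> \<gg> \<and> smooth_on \<Omega> N \<and> N ` \<Omega> \<subseteq> \<gg> \<and>
    (\<forall>u\<in>\<Omega>. \<forall>c :: 'n \<Rightarrow> real. (\<Sum>\<alpha>\<in>UNIV. c \<alpha> *\<^sub>R char_elem A B \<alpha> u) = 0 \<longrightarrow> (\<forall>\<alpha>. c \<alpha> = 0)) \<and>
    (\<forall>l. l \<noteq> 0 \<longrightarrow> (\<forall>z\<in>jet_domain \<Omega>.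
      total_y (lax_x A M l) z - total_x (lax_y B N l) z + bracket (lax_x A M l z) (lax_y B N l z)
        = (\<Sum>\<alpha>\<in>UNIV. Delta G \<alpha> z *\<^sub>R char_elem A B \<alpha> (base z))))"

end

theory Submission
  imports Defs
begin

text \<open>
  Put \<open>X\<^sub>\<alpha> = [S\<^sub>\<alpha>, M]\<close> and \<open>h\<^sub>\<alpha>\<^sub>\<beta> = f(X\<^sub>\<alpha>, X\<^sub>\<beta>, M, \<dots>, M)\<close>. The conserved density is
  \<open>L\<^sub>2 = h\<^sub>\<alpha>\<^sub>\<beta> U\<^sup>\<alpha>\<^sub>x U\<^sup>\<beta>\<^sub>x / 2\<close>, with \<open>L\<^sub>1 = 0\<close>. The zero-curvature condition gives
  \<open>\<partial>\<^sub>\<gamma> M = [B\<^sub>\<gamma>, M]\<close> and, together with the symmetry of the second derivatives of \<open>M\<close>,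
  \<open>\<partial>\<^sub>\<gamma> X\<^sub>\<alpha> = G\<^sup>\<delta>\<^sub>\<alpha>\<^sub>\<gamma> X\<^sub>\<delta> + [B\<^sub>\<gamma>, X\<^sub>\<alpha>]\<close>. All arguments of \<open>f\<close> are thus moved by
  \<open>ad B\<^sub>\<gamma>\<close> up to the \<open>G\<close>-terms, so ad-invariance leaves
  \<open>\<partial>\<^sub>\<gamma> h\<^sub>\<alpha>\<^sub>\<beta> = G\<^sup>\<delta>\<^sub>\<alpha>\<^sub>\<gamma> h\<^sub>\<delta>\<^sub>\<beta> + G\<^sup>\<delta>\<^sub>\<beta>\<^sub>\<gamma> h\<^sub>\<alpha>\<^sub>\<delta>\<close>, which is exactly \<open>D\<^sub>y L\<^sub>2 = Y\<^sub>\<alpha> \<Delta>\<^sup>\<alpha>\<close>.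
\<close>

section \<open>Partial derivatives and smooth functions\<close>

lemma partial_derivI:
  "((\<lambda>t. F (z(i := t))) has_vector_derivative d) (at (z i)) \<Longrightarrow> partial_deriv i F z = d"
  unfolding partial_deriv_def by (rule vector_derivative_at)

lemma partial_deriv_works:
  "(\<lambda>t. F (z(i := t))) differentiable at (z i) \<Longrightarrow>
    ((\<lambda>t. F (z(i := t))) has_vector_derivative partial_deriv i F z) (at (z i))"
  unfolding partial_deriv_def by (simp add: vector_derivative_works)

lemma continuous_on_fun_upd:
  fixes z :: "'i \<Rightarrow> real"
  assumes "continuous_on S g"
  shows "continuous_on S (\<lambda>t. z(i := g t))"
proof (rule continuous_on_coordinatewise_then_product)
  fix j
  show "continuous_on S (\<lambda>t. (z(i := g t)) j)"
    using assms by (cases "j = i") auto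
qed

text \<open>Coordinate lines are continuous in the product topology, so the line through
  \<open>z\<close> stays in the open set \<open>D\<close> near \<open>z\<close>. Hence partial
  derivatives at points of \<open>D\<close> see only the values on \<open>D\<close>, which the
  congruence lemmas below exploit.\<close>

lemma eventually_slice:
  fixes z :: "'i \<Rightarrow> real"
  assumes "open D" "z \<in> D"
  shows "eventually (\<lambda>t. z(i := t) \<in> D) (nhds (z i))"
proof -
  have "open ((\<lambda>t. z(i := t)) -` D)"
    using continuous_on_fun_upd[OF continuous_on_id, of UNIV z i] assms(1)
    by (simp add: continuous_on_open_vimage)
  then show ?thesis
    using assms(2) by (auto simp: eventually_nhds)
qed

lemma has_vector_derivative_slice_cong:
  fixes z :: "'i \<Rightarrow> real"
  assumes "open D" "z \<in> D" "\<And>w. w \<in> D \<Longrightarrow> F w = H w"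
  shows "((\<lambda>t. F (z(i := t))) has_vector_derivative d) (at (z i)) \<longleftrightarrow>
    ((\<lambda>t. H (z(i := t))) has_vector_derivative d) (at (z i))"
  by (rule has_vector_derivative_cong_ev)
    (use eventually_mono[OF eventually_slice[OF assms(1,2)]] assms(2,3) in auto)

lemma differentiable_slice_cong:
  fixes z :: "'i \<Rightarrow> real" and F H :: "_ \<Rightarrow> 'b::real_normed_vector"
  assumes "open D" "z \<in> D" "\<And>w. w \<in> D \<Longrightarrow> F w = H w"
  shows "(\<lambda>t. F (z(i := t))) differentiable at (z i) \<longleftrightarrow>
    (\<lambda>t. H (z(i := t))) differentiable at (z i)"
proof -
  have "f differentiable at a \<longleftrightarrow> (\<exists>d. (f has_vector_derivative d) (at a))" for f :: "real \<Rightarrow> 'b" and a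
    using vector_derivative_works differentiableI_vector by blast
  then show ?thesis
    by (simp only: has_vector_derivative_slice_cong[where F = F and H = H, OF assms])
qed

lemma partial_deriv_cong:
  fixes z :: "'i \<Rightarrow> real"
  assumes "open D" "z \<in> D" "\<And>w. w \<in> D \<Longrightarrow> F w = H w"
  shows "partial_deriv i F z = partial_deriv i H z"
  unfolding partial_deriv_def vector_derivative_def
  using has_vector_derivative_slice_cong[where F = F and H = H, OF assms] by simp

text \<open>Truncating \<open>smooth_on\<close> at a finite order makes closure properties
  accessible to induction on that order. Derivatives of the top order are only required to be
  continuous.\<close>

primrec cont_diff :: "nat \<Rightarrow> ('i \<Rightarrow> real) set \<Rightarrow> (('i \<Rightarrow> real) \<Rightarrow> 'v::real_normed_vector) \<Rightarrow> bool"
  where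
    "cont_diff 0 D F = continuous_on D F"
  | "cont_diff (Suc n) D F = (continuous_on D F \<and>
      (\<forall>i. \<forall>z\<in>D. (\<lambda>t. F (z(i := t))) differentiable at (z i)) \<and>
      (\<forall>i. cont_diff n D (partial_deriv i F)))"

text \<open>Since \<open>foldr\<close> applies the last entry of the list first, that entry is the
  innermost derivative, the one that the recursion of \<open>cont_diff\<close> peels off. The
  induction therefore splits and extends lists at their end.\<close>

lemma cont_diff_iff:
  "cont_diff n D F \<longleftrightarrow>
    (\<forall>is. (length is \<le> n \<longrightarrow> continuous_on D (foldr partial_deriv is F)) \<and>
      (length is < n \<longrightarrow> (\<forall>i. \<forall>z\<in>D. (\<lambda>t. foldr partial_deriv is F (z(i := t))) differentiable at (z i))))"
proof (induction n arbitrary: F)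
  case 0
  then show ?case by auto
next
  case (Suc n)
  show ?case (is "_ \<longleftrightarrow> ?R F")
  proof
    assume F: "cont_diff (Suc n) D F"
    show "?R F"
    proof
      fix "is" :: "'a list"
      show "(length is \<le> Suc n \<longrightarrow> continuous_on D (foldr partial_deriv is F)) \<and>
        (length is < Suc n \<longrightarrow> (\<forall>i. \<forall>z\<in>D. (\<lambda>t. foldr partial_deriv is F (z(i := t))) differentiable at (z i)))"
      proof (cases "is" rule: rev_cases)
        case Nil
        then show ?thesis using F by simp
      next
        case (snoc ys y)
        have "cont_diff n D (partial_deriv y F)" using F by simp
        then show ?thesis unfolding Suc.IH snoc by simp
      qed
    qed
  next
    assume R: "?R F"
    have "cont_diff n D (partial_deriv i F)" for i
      unfolding Suc.IH
    proof
      fix "is" :: "'a list"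
      show "(length is \<le> n \<longrightarrow> continuous_on D (foldr partial_deriv is (partial_deriv i F))) \<and>
        (length is < n \<longrightarrow> (\<forall>j. \<forall>z\<in>D. (\<lambda>t. foldr partial_deriv is (partial_deriv i F) (z(j := t))) differentiable at (z j)))"
        using spec[OF R, of "is @ [i]"] by (simp del: fun_upd_apply)
    qed
    then show "cont_diff (Suc n) D F"
      using spec[OF R, of "[]"] by (simp add: fun_upd_def)
  qed
qed

lemma smooth_on_iff_cont_diff: "smooth_on D F \<longleftrightarrow> (\<forall>n. cont_diff n D F)"
  unfolding smooth_on_def cont_diff_iff by (meson le_refl lessI)

lemma smooth_on_cont_diff: "smooth_on D F \<Longrightarrow> cont_diff n D F"
  by (simp add: smooth_on_iff_cont_diff)

lemma smooth_on_imp_continuous_on: "smooth_on D F \<Longrightarrow> continuous_on D F"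
  using smooth_on_cont_diff[of D F 0] by simp

lemma smooth_on_differentiable:
  "smooth_on D F \<Longrightarrow> z \<in> D \<Longrightarrow> (\<lambda>t. F (z(i := t))) differentiable at (z i)"
  using smooth_on_cont_diff[of D F 1] by simp

lemma smooth_on_partial_deriv: "smooth_on D F \<Longrightarrow> smooth_on D (partial_deriv i F)"
  unfolding smooth_on_iff_cont_diff by (metis cont_diff.simps(2))

lemma smooth_on_has_partial_deriv:
  assumes "smooth_on D F" "z \<in> D"
  shows "((\<lambda>t. F (z(i := t))) has_vector_derivative partial_deriv i F z) (at (z i))"
  by (rule partial_deriv_works[OF smooth_on_differentiable[OF assms]])

lemma cont_diff_lower: "cont_diff (Suc n) D F \<Longrightarrow> cont_diff n D F"
  by (induction n arbitrary: F) auto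

lemma cont_diff_cong:
  assumes "open D" "\<And>z. z \<in> D \<Longrightarrow> F z = H z" "cont_diff n D F"
  shows "cont_diff n D H"
  using assms(2,3)
proof (induction n arbitrary: F H)
  case 0
  then show ?case by (metis cont_diff.simps(1) continuous_on_cong)
next
  case (Suc n)
  then have "\<And>z i. z \<in> D \<Longrightarrow> partial_deriv i F z = partial_deriv i H z"
    using partial_deriv_cong[OF assms(1)] by blast
  then have "\<And>i. cont_diff n D (partial_deriv i H)"
    using Suc.IH[of "partial_deriv i F" "partial_deriv i H" for i] Suc.prems(2) by auto
  moreover have "continuous_on D H"
    using Suc.prems continuous_on_cong[of D D F H] by auto
  ultimately show ?case
    using Suc.prems differentiable_slice_cong[OF assms(1), of _ F H] by auto
qed

lemma smooth_on_cong:
  "open D \<Longrightarrow> (\<And>z. z \<in> D \<Longrightarrow> F z = H z) \<Longrightarrow> smooth_on D F \<Longrightarrow> smooth_on D H"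
  unfolding smooth_on_iff_cont_diff using cont_diff_cong by blast

lemma cont_diff_SucD:
  assumes "cont_diff (Suc n) D F"
  shows "continuous_on D F" "cont_diff n D (partial_deriv i F)"
    "z \<in> D \<Longrightarrow> ((\<lambda>t. F (z(i := t))) has_vector_derivative partial_deriv i F z) (at (z i))"
proof -
  show "continuous_on D F" "cont_diff n D (partial_deriv i F)"
    using assms by simp_all
  show "((\<lambda>t. F (z(i := t))) has_vector_derivative partial_deriv i F z) (at (z i))" if "z \<in> D"
    by (rule partial_deriv_works) (use assms that in simp)
qed

text \<open>The derivative may be given by an explicit formula \<open>F'\<close>. It agrees with
  \<open>partial_deriv i F\<close> only on \<open>D\<close>, and openness of \<open>D\<close>
  carries its higher derivatives over.\<close>

lemma cont_diff_SucI:
  assumes "open D" "continuous_on D F"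
    and F': "\<And>i z. z \<in> D \<Longrightarrow> ((\<lambda>t. F (z(i := t))) has_vector_derivative F' i z) (at (z i))"
    and "\<And>i. cont_diff n D (F' i)"
  shows "cont_diff (Suc n) D F"
  unfolding cont_diff.simps
proof (intro conjI allI ballI)
  show "(\<lambda>t. F (z(i := t))) differentiable at (z i)" if "z \<in> D" for i z
    by (rule differentiableI_vector[OF F'[OF that]])
  show "cont_diff n D (partial_deriv i F)" for i
  proof (rule cont_diff_cong[OF assms(1)])
    show "F' i z = partial_deriv i F z" if "z \<in> D" for z
      by (rule partial_derivI[OF F'[OF that], symmetric])
  qed (rule assms)
qed (rule assms)

lemma smooth_onI:
  assumes "open D" "continuous_on D F"
    and "\<And>i z. z \<in> D \<Longrightarrow> ((\<lambda>t. F (z(i := t))) has_vector_derivative F' i z) (at (z i))"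
    and "\<And>i. smooth_on D (F' i)"
  shows "smooth_on D F"
  unfolding smooth_on_iff_cont_diff
proof
  \<comment> \<open>Order \<open>n\<close> of every \<open>F'\<close> gives order
    \<open>Suc n\<close> of \<open>F\<close>, which is then lowered to \<open>n\<close>; this avoids
    a case distinction on \<open>n\<close>.\<close>
  show "cont_diff n D F" for n
    by (rule cont_diff_lower[OF cont_diff_SucI[where F' = F']]; (rule assms smooth_on_cont_diff)+)
qed

section \<open>Closure of smooth functions under sums and bilinear products\<close>

lemma partial_deriv_const: "partial_deriv i (\<lambda>z. c) = (\<lambda>z. 0)"
  by (auto simp: partial_deriv_def)

lemma smooth_on_const: "smooth_on D (\<lambda>z. c)"
proof -
  have "cont_diff n D (\<lambda>z. c)" for n
    by (induction n arbitrary: c) (auto simp: partial_deriv_const)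
  then show ?thesis by (simp add: smooth_on_iff_cont_diff)
qed

lemma continuous_on_coordinate: "continuous_on D (\<lambda>z :: 'i \<Rightarrow> real. z i)"
  by (intro continuous_on_subset[OF continuous_on_product_coordinates]) auto

lemma has_vector_derivative_coordinate:
  "((\<lambda>t. (z(j := t)) i) has_vector_derivative (if i = j then 1 else 0)) (at (z j))"
  by auto

lemma smooth_on_coordinate:
  assumes "open D"
  shows "smooth_on D (\<lambda>z. z i)"
  by (rule smooth_onI[OF assms continuous_on_coordinate has_vector_derivative_coordinate])
    (rule smooth_on_const)

lemma cont_diff_add:
  assumes "open D" "cont_diff n D F" "cont_diff n D H"
  shows "cont_diff n D (\<lambda>z. F z + H z)"
  using assms(2,3)
proof (induction n arbitrary: F H)
  case 0
  then show ?case by (auto intro: continuous_intros)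
next
  case (Suc n)
  show ?case
  proof (rule cont_diff_SucI[OF assms(1)])
    show "((\<lambda>t. F (z(i := t)) + H (z(i := t))) has_vector_derivative
        partial_deriv i F z + partial_deriv i H z) (at (z i))" if "z \<in> D" for i z
      by (rule has_vector_derivative_add[OF Suc.prems[THEN cont_diff_SucD(3), OF that]])
    show "cont_diff n D (\<lambda>z. partial_deriv i F z + partial_deriv i H z)" for i
      by (rule Suc.IH[OF Suc.prems[THEN cont_diff_SucD(2)]])
    show "continuous_on D (\<lambda>z. F z + H z)"
      by (rule continuous_on_add[OF Suc.prems[THEN cont_diff_SucD(1)]])
  qed
qed

lemma smooth_on_add:
  "open D \<Longrightarrow> smooth_on D F \<Longrightarrow> smooth_on D H \<Longrightarrow> smooth_on D (\<lambda>z. F z + H z)"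
  by (simp add: smooth_on_iff_cont_diff cont_diff_add)

lemma smooth_on_sum:
  assumes "open D" "\<And>j. j \<in> J \<Longrightarrow> smooth_on D (F j)"
  shows "smooth_on D (\<lambda>z. \<Sum>j\<in>J. F j z)"
  using assms(2)
proof (induction J rule: infinite_finite_induct)
  case (insert j J)
  then show ?case by (simp add: smooth_on_add[OF assms(1)])
qed (simp_all add: smooth_on_const)

lemma has_vector_derivative_slice_bilinear:
  fixes z :: "'i \<Rightarrow> real"
  assumes "bounded_bilinear b"
    "((\<lambda>t. F (z(i := t))) has_vector_derivative F') (at (z i))"
    "((\<lambda>t. H (z(i := t))) has_vector_derivative H') (at (z i))"
  shows "((\<lambda>t. b (F (z(i := t))) (H (z(i := t)))) has_vector_derivative b F' (H z) + b (F z) H') (at (z i))"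
  using bounded_bilinear.has_vector_derivative[OF assms] by (simp add: add.commute)

lemma cont_diff_bilinear:
  assumes "open D" "bounded_bilinear b" "cont_diff n D F" "cont_diff n D H"
  shows "cont_diff n D (\<lambda>z. b (F z) (H z))"
  using assms(3,4)
proof (induction n arbitrary: F H)
  case 0
  then show ?case by (auto intro: bounded_bilinear.continuous_on[OF assms(2)])
next
  case (Suc n)
  show ?case
  proof (rule cont_diff_SucI[OF assms(1)])
    show "((\<lambda>t. b (F (z(i := t))) (H (z(i := t)))) has_vector_derivative
        b (partial_deriv i F z) (H z) + b (F z) (partial_deriv i H z)) (at (z i))" if "z \<in> D" for i z
      by (rule has_vector_derivative_slice_bilinear[OF assms(2) Suc.prems[THEN cont_diff_SucD(3), OF that]])
    \<comment> \<open>Differentiation costs one factor an order; the other factor is lowered by one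
      order as well, so that both products fall under the induction hypothesis.\<close>
    show "cont_diff n D (\<lambda>z. b (partial_deriv i F z) (H z) + b (F z) (partial_deriv i H z))" for i
      by (rule cont_diff_add[OF assms(1) Suc.IH[OF cont_diff_SucD(2)[OF Suc.prems(1)] cont_diff_lower[OF Suc.prems(2)]]
            Suc.IH[OF cont_diff_lower[OF Suc.prems(1)] cont_diff_SucD(2)[OF Suc.prems(2)]]])
    show "continuous_on D (\<lambda>z. b (F z) (H z))"
      by (rule bounded_bilinear.continuous_on[OF assms(2) Suc.prems[THEN cont_diff_SucD(1)]])
  qed
qed

lemma smooth_on_bilinear:
  "open D \<Longrightarrow> bounded_bilinear b \<Longrightarrow> smooth_on D F \<Longrightarrow> smooth_on D H \<Longrightarrow>
    smooth_on D (\<lambda>z. b (F z) (H z))"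
  by (simp add: smooth_on_iff_cont_diff cont_diff_bilinear)

lemma smooth_on_diff:
  assumes "open D" "smooth_on D F" "smooth_on D H"
  shows "smooth_on D (\<lambda>z. F z - H z)"
proof -
  have "smooth_on D (\<lambda>z. F z + (- 1 :: real) *\<^sub>R H z)"
    by (intro smooth_on_add smooth_on_bilinear[OF _ bounded_bilinear_scaleR] smooth_on_const assms)
  then show ?thesis by simp
qed

text \<open>The mixed second difference over a square equals both mixed derivatives at
  intermediate points, by the mean value theorem applied in either order.\<close>

lemma clairaut_real:
  fixes \<phi> :: "real \<Rightarrow> real \<Rightarrow> real"
  assumes W: "open W" "(a, b) \<in> W"
    and s: "\<And>s t. (s, t) \<in> W \<Longrightarrow> ((\<lambda>s. \<phi> s t) has_real_derivative \<phi>s s t) (at s)"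
    and t: "\<And>s t. (s, t) \<in> W \<Longrightarrow> ((\<lambda>t. \<phi> s t) has_real_derivative \<phi>t s t) (at t)"
    and st: "\<And>s t. (s, t) \<in> W \<Longrightarrow> ((\<lambda>t. \<phi>s s t) has_real_derivative \<phi>st s t) (at t)"
    and ts: "\<And>s t. (s, t) \<in> W \<Longrightarrow> ((\<lambda>s. \<phi>t s t) has_real_derivative \<phi>ts s t) (at s)"
    and cont: "continuous_on W (\<lambda>(s, t). \<phi>st s t)" "continuous_on W (\<lambda>(s, t). \<phi>ts s t)"
  shows "\<phi>st a b = \<phi>ts a b"
proof (rule ccontr)
  assume ne: "\<phi>st a b \<noteq> \<phi>ts a b"
  \<comment> \<open>Half the supposed gap: two errors below \<open>e\<close> cannot add up to the
    whole gap.\<close>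
  define e where "e = \<bar>\<phi>st a b - \<phi>ts a b\<bar> / 2"
  have "e > 0" using ne by (simp add: e_def)
  obtain d0 where d0: "d0 > 0" "ball (a, b) d0 \<subseteq> W"
    using W open_contains_ball by blast
  obtain d1 where d1: "d1 > 0" "\<And>w. w \<in> W \<Longrightarrow> dist w (a, b) < d1 \<Longrightarrow> \<bar>\<phi>st (fst w) (snd w) - \<phi>st a b\<bar> < e"
    using cont(1)[unfolded continuous_on_iff, rule_format, OF W(2) \<open>e > 0\<close>]
    by (auto simp: dist_real_def split_def)
  obtain d2 where d2: "d2 > 0" "\<And>w. w \<in> W \<Longrightarrow> dist w (a, b) < d2 \<Longrightarrow> \<bar>\<phi>ts (fst w) (snd w) - \<phi>ts a b\<bar> < e"
    using cont(2)[unfolded continuous_on_iff, rule_format, OF W(2) \<open>e > 0\<close>]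
    by (auto simp: dist_real_def split_def)
  \<comment> \<open>Points of the square of side \<open>h\<close> with corner \<open>(a, b)\<close>
    are at distance at most \<open>2 * h\<close> from that corner, and \<open>3 * h\<close> is three
    quarters of the smallest of the three radii.\<close>
  define h where "h = min d0 (min d1 d2) / 4"
  have h: "h > 0"
    using d0 d1 d2 by (simp add: h_def)
  have near: "dist (x, y) (a, b) < 3 * h" if "a \<le> x" "x \<le> a + h" "b \<le> y" "y \<le> b + h" for x y
  proof -
    have "dist (x, y) (a, b) \<le> \<bar>x - a\<bar> + \<bar>y - b\<bar>"
      unfolding dist_Pair_Pair dist_real_def power2_abs by (rule sqrt_sum_squares_le_sum_abs)
    then show ?thesis using that h by linarith
  qed
  have h3: "3 * h < d0" "3 * h < d1" "3 * h < d2"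
    using d0 d1 d2 by (auto simp: h_def)
  have box: "(x, y) \<in> W" if "a \<le> x" "x \<le> a + h" "b \<le> y" "y \<le> b + h" for x y
    using near[OF that] h3 d0(2) by (auto simp: dist_commute subset_iff)
  have MVT: "\<exists>x. c < x \<and> x < c + h \<and> g (c + h) - g c = h * g' x"
    if "\<And>x. c \<le> x \<Longrightarrow> x \<le> c + h \<Longrightarrow> (g has_real_derivative g' x) (at x)" for c g g'
    using MVT2[of c "c + h" g g'] that h by auto
  have h': "a \<le> a + h" "b \<le> b + h" using h by simp_all
  have "\<exists>x. a < x \<and> x < a + h \<and>
    (\<phi> (a + h) (b + h) - \<phi> (a + h) b) - (\<phi> a (b + h) - \<phi> a b) = h * (\<phi>s x (b + h) - \<phi>s x b)"
    by (rule MVT) (intro DERIV_diff s box order_refl h'; assumption)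
  then obtain x where x: "a < x" "x < a + h"
    "(\<phi> (a + h) (b + h) - \<phi> (a + h) b) - (\<phi> a (b + h) - \<phi> a b) = h * (\<phi>s x (b + h) - \<phi>s x b)"
    by blast
  have "\<exists>y. b < y \<and> y < b + h \<and> \<phi>s x (b + h) - \<phi>s x b = h * \<phi>st x y"
    by (rule MVT) (intro st box less_imp_le[OF x(1)] less_imp_le[OF x(2)]; assumption)
  then obtain y where y: "b < y" "y < b + h" "\<phi>s x (b + h) - \<phi>s x b = h * \<phi>st x y"
    by blast
  have "\<exists>y. b < y \<and> y < b + h \<and>
    (\<phi> (a + h) (b + h) - \<phi> a (b + h)) - (\<phi> (a + h) b - \<phi> a b) = h * (\<phi>t (a + h) y - \<phi>t a y)"
    by (rule MVT) (intro DERIV_diff t box order_refl h'; assumption)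
  then obtain y' where y': "b < y'" "y' < b + h"
    "(\<phi> (a + h) (b + h) - \<phi> a (b + h)) - (\<phi> (a + h) b - \<phi> a b) = h * (\<phi>t (a + h) y' - \<phi>t a y')"
    by blast
  have "\<exists>x. a < x \<and> x < a + h \<and> \<phi>t (a + h) y' - \<phi>t a y' = h * \<phi>ts x y'"
    by (rule MVT) (intro ts box less_imp_le[OF y'(1)] less_imp_le[OF y'(2)]; assumption)
  then obtain x' where x': "a < x'" "x' < a + h" "\<phi>t (a + h) y' - \<phi>t a y' = h * \<phi>ts x' y'"
    by blast
  have "h * (h * \<phi>st x y) = h * (h * \<phi>ts x' y')"
    using x(3)[unfolded y(3)] y'(3)[unfolded x'(3)] by linarith
  then have "\<phi>st x y = \<phi>ts x' y'" using h by simp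
  moreover have "\<bar>\<phi>st x y - \<phi>st a b\<bar> < e"
    using d1(2)[of "(x, y)"] near[of x y] box[of x y] x y h3 by simp
  moreover have "\<bar>\<phi>ts x' y' - \<phi>ts a b\<bar> < e"
    using d2(2)[of "(x', y')"] near[of x' y'] box[of x' y'] x' y' h3 by simp
  ultimately have "\<bar>\<phi>st x y - \<phi>st a b\<bar> + \<bar>\<phi>st x y - \<phi>ts a b\<bar> < 2 * e"
    by simp
  then have "\<bar>\<phi>st a b - \<phi>ts a b\<bar> < 2 * e"
    by arith
  then show False by (simp add: e_def)
qed

text \<open>Restricting \<open>F\<close> to the plane of the coordinates \<open>i\<close> and
  \<open>j\<close> and pairing it with a fixed vector reduces the claim to
  \<open>clairaut_real\<close>. With the difference of the two mixed derivatives as that vector, its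
  norm is forced to vanish.\<close>

lemma partial_deriv_commute:
  fixes F :: "('i \<Rightarrow> real) \<Rightarrow> 'v::real_inner"
  assumes "open D" "smooth_on D F" "u \<in> D"
  shows "partial_deriv i (partial_deriv j F) u = partial_deriv j (partial_deriv i F) u"
proof (cases "i = j")
  case False
  define v where "v = partial_deriv i (partial_deriv j F) u - partial_deriv j (partial_deriv i F) u"
  define w where "w s t = u(i := s, j := t)" for s t
  define W where "W = {(s, t). w s t \<in> D}"
  have wc: "continuous_on UNIV (\<lambda>(s, t). w s t)"
    unfolding w_def split_def
  proof (rule continuous_on_coordinatewise_then_product)
    show "continuous_on UNIV (\<lambda>x. (u(i := fst x, j := snd x)) k)" for k
      by (cases "k = j"; cases "k = i") (auto intro!: continuous_intros)
  qed
  have "W = (\<lambda>(s, t). w s t) -` D" by (auto simp: W_def)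
  then have W: "open W"
    using wc assms(1) by (simp add: continuous_on_open_vimage)
  have i: "((\<lambda>s. H (w s t) \<bullet> v) has_real_derivative partial_deriv i H (w s t) \<bullet> v) (at s)"
    if "smooth_on D H" "(s, t) \<in> W" for H s t
  proof -
    have "((\<lambda>r. H ((w s t)(i := r))) has_vector_derivative partial_deriv i H (w s t)) (at (w s t i))"
      using smooth_on_has_partial_deriv[of D H "w s t" i] that by (auto simp: W_def)
    moreover have "(w s t)(i := r) = w r t" for r using False by (auto simp: w_def)
    moreover have "w s t i = s" using False by (auto simp: w_def)
    ultimately have "((\<lambda>r. H (w r t)) has_vector_derivative partial_deriv i H (w s t)) (at s)" by simp
    from bounded_linear.has_vector_derivative[OF bounded_linear_inner_left this]
    show ?thesis by (simp add: has_real_derivative_iff_has_vector_derivative)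
  qed
  have j: "((\<lambda>t. H (w s t) \<bullet> v) has_real_derivative partial_deriv j H (w s t) \<bullet> v) (at t)"
    if "smooth_on D H" "(s, t) \<in> W" for H s t
  proof -
    have "((\<lambda>r. H ((w s t)(j := r))) has_vector_derivative partial_deriv j H (w s t)) (at (w s t j))"
      using smooth_on_has_partial_deriv[of D H "w s t" j] that by (auto simp: W_def)
    moreover have "(w s t)(j := r) = w s r" for r by (auto simp: w_def)
    moreover have "w s t j = t" by (auto simp: w_def)
    ultimately have "((\<lambda>r. H (w s r)) has_vector_derivative partial_deriv j H (w s t)) (at t)" by simp
    from bounded_linear.has_vector_derivative[OF bounded_linear_inner_left this]
    show ?thesis by (simp add: has_real_derivative_iff_has_vector_derivative)
  qed
  have c: "continuous_on W (\<lambda>(s, t). H (w s t) \<bullet> v)" if "smooth_on D H" for H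
  proof -
    have "continuous_on W (\<lambda>p. H ((\<lambda>(s, t). w s t) p))"
      by (rule continuous_on_compose2[OF smooth_on_imp_continuous_on[OF that] continuous_on_subset[OF wc]])
        (auto simp: W_def)
    then show ?thesis by (auto simp: split_def intro: continuous_intros)
  qed
  have w: "w (u i) (u j) = u" by (simp add: w_def)
  have "partial_deriv j (partial_deriv i F) (w (u i) (u j)) \<bullet> v
      = partial_deriv i (partial_deriv j F) (w (u i) (u j)) \<bullet> v"
    by (rule clairaut_real[OF W, where \<phi> = "\<lambda>s t. F (w s t) \<bullet> v"
          and \<phi>s = "\<lambda>s t. partial_deriv i F (w s t) \<bullet> v" and \<phi>t = "\<lambda>s t. partial_deriv j F (w s t) \<bullet> v"])
      (use assms w in \<open>auto simp: W_def intro: i[unfolded W_def] j[unfolded W_def] c[unfolded W_def] smooth_on_partial_deriv\<close>)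
  then have "v \<bullet> v = 0"
    unfolding w by (simp add: v_def inner_diff_left)
  then show ?thesis by (simp add: v_def)
qed simp

section \<open>Multilinear functions of lists\<close>

definition multilinear :: "nat \<Rightarrow> ('a::real_vector list \<Rightarrow> 's::real_vector) \<Rightarrow> bool"
  where "multilinear p g \<longleftrightarrow>
    (\<forall>Xs i. length Xs = p \<longrightarrow> i < p \<longrightarrow> linear (\<lambda>X. g (Xs[i := X])))"

lemma multilinear_Cons: "multilinear (Suc p) g \<Longrightarrow> multilinear p (\<lambda>Xs. g (X # Xs))"
  unfolding multilinear_def
proof (intro allI impI)
  fix Xs :: "'a list" and i
  assume *: "\<forall>Xs i. length Xs = Suc p \<longrightarrow> i < Suc p \<longrightarrow> linear (\<lambda>X. g (Xs[i := X]))"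
    and "length Xs = p" "i < p"
  then show "linear (\<lambda>Y. g (X # Xs[i := Y]))"
    using *[rule_format, of "X # Xs" "Suc i"] by simp
qed

lemma multilinear_head: "multilinear (Suc p) g \<Longrightarrow> length Xs = p \<Longrightarrow> linear (\<lambda>X. g (X # Xs))"
  unfolding multilinear_def
proof -
  assume *: "\<forall>(Xs :: 'a list) i. length Xs = Suc p \<longrightarrow> i < Suc p \<longrightarrow> linear (\<lambda>X. g (Xs[i := X]))"
    and "length Xs = p"
  then show "linear (\<lambda>X. g (X # Xs))"
    \<comment> \<open>The head \<open>undefined\<close> is a placeholder, overwritten by the update
      at position 0.\<close>
    using *[rule_format, of "undefined # Xs" 0] by simp
qed

text \<open>Expanding the first argument in the basis trades it for finitely many scalar
  coefficients in front of forms with one slot fewer. This drives the inductions for smoothness and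
  for the Leibniz rule.\<close>

lemma multilinear_expand:
  fixes g :: "'a::euclidean_space list \<Rightarrow> 's::real_vector"
  assumes "multilinear (Suc p) g" "length Xs = p"
  shows "g (X # Xs) = (\<Sum>b\<in>Basis. (X \<bullet> b) *\<^sub>R g (b # Xs))"
proof -
  have "g (X # Xs) = g ((\<Sum>b\<in>Basis. (X \<bullet> b) *\<^sub>R b) # Xs)"
    by (simp add: euclidean_representation)
  also have "\<dots> = (\<Sum>b\<in>Basis. (X \<bullet> b) *\<^sub>R g (b # Xs))"
    using linear_sum[OF multilinear_head[OF assms], of "\<lambda>b. (X \<bullet> b) *\<^sub>R b" Basis]
    by (simp add: linear_scale[OF multilinear_head[OF assms]])
  finally show ?thesis .
qed

lemma smooth_on_multilinear:
  fixes g :: "'a::euclidean_space list \<Rightarrow> 's::real_normed_vector"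
  assumes "open D" "multilinear (length Fs) g" "\<And>F. F \<in> set Fs \<Longrightarrow> smooth_on D F"
  shows "smooth_on D (\<lambda>z. g (map (\<lambda>F. F z) Fs))"
  using assms(2,3)
proof (induction Fs arbitrary: g)
  case Nil
  then show ?case by (simp add: smooth_on_const)
next
  case (Cons F Fs)
  have g: "multilinear (Suc (length Fs)) g"
    using Cons.prems(1) by simp
  have "smooth_on D (\<lambda>z. \<Sum>b\<in>Basis. (F z \<bullet> b) *\<^sub>R g (b # map (\<lambda>F. F z) Fs))"
  proof (intro smooth_on_sum smooth_on_bilinear[OF _ bounded_bilinear_scaleR] assms(1))
    show "smooth_on D (\<lambda>z. F z \<bullet> b)" for b
      using Cons.prems(2)[of F]
      by (intro smooth_on_bilinear[OF assms(1) bounded_bilinear_inner] smooth_on_const) simp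
    show "smooth_on D (\<lambda>z. g (b # map (\<lambda>F. F z) Fs))" for b
      by (rule Cons.IH[OF multilinear_Cons[OF g] Cons.prems(2)]) simp
  qed
  then show ?case
    by (simp add: multilinear_expand[OF g])
qed

text \<open>The Leibniz rule, by induction on the number of slots: after basis expansion only the
  product rule for scalar times vector is needed, and the basis sums are reassembled afterwards. The
  form \<open>g\<close> varies in the induction because fixing a basis vector in its head changes
  it.\<close>

lemma has_vector_derivative_multilinear:
  fixes g :: "'a::euclidean_space list \<Rightarrow> 's::real_normed_vector"
  assumes "multilinear (length Fs) g" "list_all2 (\<lambda>F F'. (F has_vector_derivative F') (at t)) Fs Fs'"
  shows "((\<lambda>t. g (map (\<lambda>F. F t) Fs)) has_vector_derivative
    (\<Sum>i<length Fs. g ((map (\<lambda>F. F t) Fs)[i := Fs' ! i]))) (at t)"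
  using assms(2,1)
proof (induction Fs Fs' arbitrary: g rule: list_all2_induct)
  case Nil
  then show ?case by simp
next
  case (Cons F Fs F' Fs')
  have g: "multilinear (Suc (length Fs)) g"
    using Cons.prems by simp
  define e where "e = (\<lambda>i. (map (\<lambda>F. F t) Fs)[i := Fs' ! i])"
  have len: "length (e i) = length Fs" for i
    by (simp add: e_def)
  have d: "((\<lambda>t. (F t \<bullet> b) *\<^sub>R g (b # map (\<lambda>F. F t) Fs)) has_vector_derivative
      (F t \<bullet> b) *\<^sub>R (\<Sum>i<length Fs. g (b # e i)) + (F' \<bullet> b) *\<^sub>R g (b # map (\<lambda>F. F t) Fs)) (at t)" for b
    unfolding e_def
    by (rule bounded_bilinear.has_vector_derivative[OF bounded_bilinear_scaleR
          bounded_linear.has_vector_derivative[OF bounded_linear_inner_left Cons.hyps(1)]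
          Cons.IH[OF multilinear_Cons[OF g]]])
  have "((\<lambda>t. \<Sum>b\<in>Basis. (F t \<bullet> b) *\<^sub>R g (b # map (\<lambda>F. F t) Fs)) has_vector_derivative
      (\<Sum>b\<in>Basis. (F t \<bullet> b) *\<^sub>R (\<Sum>i<length Fs. g (b # e i)) + (F' \<bullet> b) *\<^sub>R g (b # map (\<lambda>F. F t) Fs))) (at t)"
    by (rule has_vector_derivative_sum[OF d])
  also have "(\<Sum>b\<in>Basis. (F t \<bullet> b) *\<^sub>R (\<Sum>i<length Fs. g (b # e i)) + (F' \<bullet> b) *\<^sub>R g (b # map (\<lambda>F. F t) Fs))
      = (\<Sum>i<length Fs. \<Sum>b\<in>Basis. (F t \<bullet> b) *\<^sub>R g (b # e i)) + g (F' # map (\<lambda>F. F t) Fs)"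
    by (subst sum.swap)
      (simp add: sum.distrib scaleR_sum_right multilinear_expand[OF g, of "map (\<lambda>F. F t) Fs" F'])
  also have "\<dots> = (\<Sum>i<length Fs. g (F t # e i)) + g (F' # map (\<lambda>F. F t) Fs)"
    by (simp add: multilinear_expand[OF g len, symmetric])
  \<comment> \<open>Slot 0 carries \<open>F'\<close>; slot \<open>i\<close> of the tail becomes slot
    \<open>Suc i\<close> of the full list.\<close>
  also have "\<dots> = (\<Sum>i<length (F # Fs). g ((map (\<lambda>F. F t) (F # Fs))[i := (F' # Fs') ! i]))"
    by (simp add: sum.lessThan_Suc_shift e_def del: sum.lessThan_Suc)
  finally show ?case
    by (simp add: multilinear_expand[OF g, symmetric])
qed

text \<open>Precomposing every argument with a linear projection onto \<open>V\<close> gives a form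
  that is multilinear on the whole space and unchanged on \<open>V\<close>. Differentiation can then
  treat arbitrary arguments without checking membership in \<open>V\<close>.\<close>

lemma symmetric_form_extend:
  fixes f :: "'a::euclidean_space list \<Rightarrow> 's::real_vector"
  assumes "subspace V" "symmetric_form V p f"
  obtains g where "multilinear p g" "\<And>Xs. length Xs = p \<Longrightarrow> set Xs \<subseteq> V \<Longrightarrow> g Xs = f Xs"
proof -
  \<comment> \<open>A linear left inverse of the identity on \<open>V\<close>, with range in
    \<open>V\<close>, is a projection onto \<open>V\<close>.\<close>
  obtain P where P: "linear P" "range P \<subseteq> V" "\<And>x. x \<in> V \<Longrightarrow> P x = x"
    using linear_exists_left_inverse_on[OF linear_id assms(1)] by (auto simp: id_def)
  have PV: "P x \<in> V" for x
    using P(2) by blast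
  have "multilinear p (\<lambda>Xs. f (map P Xs))"
    unfolding multilinear_def
  proof (intro allI impI)
    fix Xs :: "'a list" and i
    assume Xs: "length Xs = p" "i < p"
    have f: "f ((map P Xs)[i := a *\<^sub>R X + b *\<^sub>R Y]) = a *\<^sub>R f ((map P Xs)[i := X]) + b *\<^sub>R f ((map P Xs)[i := Y])"
      if "X \<in> V" "Y \<in> V" for X Y a b
    proof -
      have "length (map P Xs) = p \<and> set (map P Xs) \<subseteq> V"
        using Xs(1) PV by auto
      then show ?thesis
        using assms(2) Xs(2) that unfolding symmetric_form_def by blast
    qed
    show "linear (\<lambda>X. f (map P (Xs[i := X])))"
    proof (rule linearI)
      show "f (map P (Xs[i := X + Y])) = f (map P (Xs[i := X])) + f (map P (Xs[i := Y]))" for X Y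
        using f[OF PV PV, of 1 X 1 Y] by (simp add: map_update linear_add[OF P(1)])
      show "f (map P (Xs[i := c *\<^sub>R X])) = c *\<^sub>R f (map P (Xs[i := X]))" for c X
        using f[OF PV PV, of c X 0 X] by (simp add: map_update linear_scale[OF P(1)])
    qed
  qed
  moreover have "f (map P Xs) = f Xs" if "set Xs \<subseteq> V" for Xs
  proof -
    have "map P Xs = Xs"
      using that P(3) by (intro map_idI) blast
    then show ?thesis by simp
  qed
  ultimately show ?thesis
    using that by blast
qed

section \<open>Total derivatives of functions of low order\<close>

lemma base_apply: "base z \<alpha> = z (0, 0, \<alpha>)"
  by (simp add: base_def)

lemma base_upd_base: "base (z((0, 0, \<alpha>) := t)) = (base z)(\<alpha> := t)"
  by (auto simp: base_def)

lemma base_upd_other: "(i, j) \<noteq> (0, 0) \<Longrightarrow> base (z((i, j, \<alpha>) := t)) = base z"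
  by (auto simp: base_def)

lemma open_jet_domain:
  assumes "open \<Omega>"
  shows "open (jet_domain \<Omega>)"
proof -
  have "continuous_on UNIV (base :: 'a jet \<Rightarrow> _)"
    unfolding base_def by (intro continuous_on_coordinatewise_then_product continuous_on_coordinate)
  moreover have "jet_domain \<Omega> = base -` \<Omega>"
    by (auto simp: jet_domain_def)
  ultimately show ?thesis
    using assms by (simp add: continuous_on_open_vimage)
qed

lemma has_vector_derivative_base:
  assumes "smooth_on \<Omega> F" "z \<in> jet_domain \<Omega>"
  shows "((\<lambda>t. F ((base z)(\<alpha> := t))) has_vector_derivative partial_deriv \<alpha> F (base z)) (at (z (0, 0, \<alpha>)))"
  using smooth_on_has_partial_deriv[OF assms(1), of "base z" \<alpha>] assms(2)
  by (simp add: jet_domain_def base_def)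

text \<open>A partial derivative of \<open>F\<close> composed with \<open>base\<close> is either
  zero or again a partial derivative of \<open>F\<close> composed with \<open>base\<close>, so the
  induction on the order closes.\<close>

lemma cont_diff_base:
  assumes "open \<Omega>" "cont_diff n \<Omega> F"
  shows "cont_diff n (jet_domain \<Omega>) (\<lambda>z. F (base z))"
proof -
  have c: "continuous_on (jet_domain \<Omega>) (\<lambda>z. F (base z))" if "continuous_on \<Omega> F" for F :: "_ \<Rightarrow> 'b"
  proof (rule continuous_on_compose2[OF that])
    show "continuous_on (jet_domain \<Omega>) base"
      unfolding base_def by (intro continuous_on_coordinatewise_then_product continuous_on_coordinate)
  qed (auto simp: jet_domain_def)
  show ?thesis
    using assms(2)
  proof (induction n arbitrary: F)
    case 0
    then show ?case by (simp add: c)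
  next
    case (Suc n)
    show ?case
    proof (rule cont_diff_SucI[OF open_jet_domain[OF assms(1)] c[OF cont_diff_SucD(1)[OF Suc.prems]],
          where F' = "\<lambda>(i, j, \<alpha>) z. if (i, j) = (0, 0) then partial_deriv \<alpha> F (base z) else 0"])
      fix v :: "'a jet_var" and z :: "'a jet"
      assume z: "z \<in> jet_domain \<Omega>"
      obtain i j \<alpha> where v: "v = (i, j, \<alpha>)" by (cases v)
      show "((\<lambda>t. F (base (z(v := t)))) has_vector_derivative
        (case v of (i, j, \<alpha>) \<Rightarrow> \<lambda>z. if (i, j) = (0, 0) then partial_deriv \<alpha> F (base z) else 0) z) (at (z v))"
      proof (cases "(i, j) = (0, 0)")
        case True
        then have "v = (0, 0, \<alpha>)" by (simp add: v)
        then show ?thesis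
          using cont_diff_SucD(3)[OF Suc.prems, of "base z" \<alpha>] z
          by (simp add: base_upd_base jet_domain_def base_apply del: fun_upd_apply)
      next
        case False
        then show ?thesis
          unfolding v base_upd_other[OF False] by auto
      qed
    next
      fix v :: "'a jet_var"
      obtain i j \<alpha> where v: "v = (i, j, \<alpha>)" by (cases v)
      show "cont_diff n (jet_domain \<Omega>)
        ((case v of (i, j, \<alpha>) \<Rightarrow> \<lambda>z. if (i, j) = (0, 0) then partial_deriv \<alpha> F (base z) else 0))"
        using Suc.IH[OF cont_diff_SucD(2)[OF Suc.prems]]
        by (cases i; cases j) (simp_all add: v smooth_on_cont_diff[OF smooth_on_const])
    qed
  qed
qed

lemma smooth_on_base:
  "open \<Omega> \<Longrightarrow> smooth_on \<Omega> F \<Longrightarrow> smooth_on (jet_domain \<Omega>) (\<lambda>z. F (base z))"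
  by (simp add: smooth_on_iff_cont_diff cont_diff_base)

lemma Ux_upd: "Ux \<beta> (z((i, j, \<alpha>) := t)) = (if (i, j, \<alpha>) = (1, 0, \<beta>) then t else Ux \<beta> z)"
  by (auto simp: Ux_def)

lemma Uy_upd: "Uy \<beta> (z((i, j, \<alpha>) := t)) = (if (i, j, \<alpha>) = (0, 1, \<beta>) then t else Uy \<beta> z)"
  by (auto simp: Uy_def)

lemma partial_deriv_eq_0: "(\<And>t. F (z(v := t)) = F z) \<Longrightarrow> partial_deriv v F z = 0"
  by (rule partial_derivI) simp

text \<open>The nonzero summands lie in the two finite families of variables
  \<open>(0, 0, \<alpha>)\<close> and \<open>(1, 0, \<alpha>)\<close>, so \<open>Sum_any\<close>
  becomes an ordinary sum; raising the \<open>y\<close> order turns these variables into those read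
  by \<open>Uy\<close> and \<open>Uxy\<close>.\<close>

lemma total_y_eq:
  fixes F :: "'n::finite jet \<Rightarrow> 'v::real_normed_vector"
  assumes "\<And>i j \<alpha>. (i, j) \<noteq> (0, 0) \<Longrightarrow> (i, j) \<noteq> (1, 0) \<Longrightarrow> partial_deriv (i, j, \<alpha>) F z = 0"
  shows "total_y F z =
    (\<Sum>\<alpha>\<in>UNIV. Uy \<alpha> z *\<^sub>R partial_deriv (0, 0, \<alpha>) F z + Uxy \<alpha> z *\<^sub>R partial_deriv (1, 0, \<alpha>) F z)"
proof -
  let ?g = "\<lambda>(i, j, \<alpha>). z (i, Suc j, \<alpha>) *\<^sub>R partial_deriv (i, j, \<alpha>) F z"
  let ?S0 = "range (\<lambda>\<alpha>. (0, 0, \<alpha>)) :: 'n jet_var set"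
  let ?S1 = "range (\<lambda>\<alpha>. (1, 0, \<alpha>)) :: 'n jet_var set"
  have "{v. ?g v \<noteq> 0} \<subseteq> ?S0 \<union> ?S1"
  proof
    fix v
    assume v: "v \<in> {v. ?g v \<noteq> 0}"
    obtain i j \<alpha> where ij: "v = (i, j, \<alpha>)" by (cases v)
    then have "partial_deriv (i, j, \<alpha>) F z \<noteq> 0"
      using v by simp
    then have "(i, j) = (0, 0) \<or> (i, j) = (1, 0)"
      using assms by blast
    then show "v \<in> ?S0 \<union> ?S1" using ij by auto
  qed
  then have "total_y F z = sum ?g (?S0 \<union> ?S1)"
    unfolding total_y_def by (intro Sum_any.expand_superset) auto
  also have "\<dots> = sum ?g ?S0 + sum ?g ?S1"
    by (intro sum.union_disjoint) auto
  finally show ?thesis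
    by (simp add: sum.reindex inj_on_def sum.distrib Uy_def Uxy_def)
qed

lemma total_x_eq:
  fixes F :: "'n::finite jet \<Rightarrow> 'v::real_normed_vector"
  assumes "\<And>i j \<alpha>. (i, j) \<noteq> (0, 0) \<Longrightarrow> (i, j) \<noteq> (0, 1) \<Longrightarrow> partial_deriv (i, j, \<alpha>) F z = 0"
  shows "total_x F z =
    (\<Sum>\<alpha>\<in>UNIV. Ux \<alpha> z *\<^sub>R partial_deriv (0, 0, \<alpha>) F z + Uxy \<alpha> z *\<^sub>R partial_deriv (0, 1, \<alpha>) F z)"
proof -
  let ?g = "\<lambda>(i, j, \<alpha>). z (Suc i, j, \<alpha>) *\<^sub>R partial_deriv (i, j, \<alpha>) F z"
  let ?S0 = "range (\<lambda>\<alpha>. (0, 0, \<alpha>)) :: 'n jet_var set"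
  let ?S1 = "range (\<lambda>\<alpha>. (0, 1, \<alpha>)) :: 'n jet_var set"
  have "{v. ?g v \<noteq> 0} \<subseteq> ?S0 \<union> ?S1"
  proof
    fix v
    assume v: "v \<in> {v. ?g v \<noteq> 0}"
    obtain i j \<alpha> where ij: "v = (i, j, \<alpha>)" by (cases v)
    then have "partial_deriv (i, j, \<alpha>) F z \<noteq> 0"
      using v by simp
    then have "(i, j) = (0, 0) \<or> (i, j) = (0, 1)"
      using assms by blast
    then show "v \<in> ?S0 \<union> ?S1" using ij by auto
  qed
  then have "total_x F z = sum ?g (?S0 \<union> ?S1)"
    unfolding total_x_def by (intro Sum_any.expand_superset) auto
  also have "\<dots> = sum ?g ?S0 + sum ?g ?S1"
    by (intro sum.union_disjoint) auto
  finally show ?thesis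
    by (simp add: sum.reindex inj_on_def sum.distrib Ux_def Uxy_def)
qed

lemma sum_delta_scaleR:
  fixes A :: "'n::finite \<Rightarrow> 'v::real_vector"
  shows "(\<Sum>\<beta>\<in>UNIV. (if \<alpha> = \<beta> then 1 else 0) *\<^sub>R A \<beta>) = A \<alpha>"
proof -
  have "(\<Sum>\<beta>\<in>UNIV. (if \<alpha> = \<beta> then 1 else 0) *\<^sub>R A \<beta>) = (\<Sum>\<beta>\<in>UNIV. if \<alpha> = \<beta> then A \<beta> else 0)"
    by (rule sum.cong) auto
  then show ?thesis by simp
qed

lemma total_y_lax_x:
  fixes z :: "'n::finite jet" and M :: "_ \<Rightarrow> 'v::real_normed_vector"
  assumes "\<And>\<beta>. smooth_on \<Omega> (A \<beta>)" "smooth_on \<Omega> M" "z \<in> jet_domain \<Omega>"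
  shows "total_y (lax_x A M l) z = (\<Sum>\<alpha>\<in>UNIV.
    Uy \<alpha> z *\<^sub>R ((\<Sum>\<beta>\<in>UNIV. Ux \<beta> z *\<^sub>R partial_deriv \<alpha> (A \<beta>) (base z)) + l *\<^sub>R partial_deriv \<alpha> M (base z))
    + Uxy \<alpha> z *\<^sub>R A \<alpha> (base z))"
proof -
  have 1: "partial_deriv (0, 0, \<alpha>) (lax_x A M l) z =
      (\<Sum>\<beta>\<in>UNIV. Ux \<beta> z *\<^sub>R partial_deriv \<alpha> (A \<beta>) (base z)) + l *\<^sub>R partial_deriv \<alpha> M (base z)" for \<alpha>
  proof (rule partial_derivI)
    show "((\<lambda>t. lax_x A M l (z((0, 0, \<alpha>) := t))) has_vector_derivative
      (\<Sum>\<beta>\<in>UNIV. Ux \<beta> z *\<^sub>R partial_deriv \<alpha> (A \<beta>) (base z)) + l *\<^sub>R partial_deriv \<alpha> M (base z))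
      (at (z (0, 0, \<alpha>)))"
      unfolding lax_x_def base_upd_base Ux_upd
      by (simp del: fun_upd_apply, intro has_vector_derivative_add has_vector_derivative_sum
          bounded_linear.has_vector_derivative[OF bounded_linear_scaleR_right]
          has_vector_derivative_base[OF _ assms(3)] assms)
  qed
  have 2: "partial_deriv (1, 0, \<alpha>) (lax_x A M l) z = A \<alpha> (base z)" for \<alpha>
  proof (rule partial_derivI)
    \<comment> \<open>The indicator is the derivative of one coordinate along another; it later
      collapses the sum to the single term \<open>A \<alpha>\<close>.\<close>
    have "((\<lambda>t. (\<Sum>\<beta>\<in>UNIV. (z((1, 0, \<alpha>) := t)) (1, 0, \<beta>) *\<^sub>R A \<beta> (base z)) + l *\<^sub>R M (base z))
      has_vector_derivative (\<Sum>\<beta>\<in>UNIV. (if (1 :: nat, 0 :: nat, \<beta>) = (1, 0, \<alpha>) then 1 else 0) *\<^sub>R A \<beta> (base z)) + 0)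
      (at (z (1, 0, \<alpha>)))"
      by (intro has_vector_derivative_add has_vector_derivative_sum has_vector_derivative_const
          bounded_linear.has_vector_derivative[OF bounded_linear_scaleR_left]
          has_vector_derivative_coordinate)
    then show "((\<lambda>t. lax_x A M l (z((1, 0, \<alpha>) := t))) has_vector_derivative A \<alpha> (base z))
      (at (z (1, 0, \<alpha>)))"
      unfolding lax_x_def Ux_def
      using sum_delta_scaleR[of \<alpha> "\<lambda>\<beta>. A \<beta> (base z)"]
      by (simp add: base_upd_other eq_commute[of _ \<alpha>] cong: if_cong del: fun_upd_apply)
  qed
  have 3: "partial_deriv (i, j, \<alpha>) (lax_x A M l) z = 0" if "(i, j) \<noteq> (0, 0)" "(i, j) \<noteq> (1, 0)" for i j \<alpha>
    using that by (intro partial_deriv_eq_0) (auto simp: lax_x_def base_upd_other Ux_upd)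
  have "total_y (lax_x A M l) z = (\<Sum>\<alpha>\<in>UNIV.
      Uy \<alpha> z *\<^sub>R partial_deriv (0, 0, \<alpha>) (lax_x A M l) z
      + Uxy \<alpha> z *\<^sub>R partial_deriv (1, 0, \<alpha>) (lax_x A M l) z)"
    by (rule total_y_eq) (rule 3)
  then show ?thesis
    unfolding 1 2 .
qed

lemma total_x_lax_y:
  fixes z :: "'n::finite jet" and N :: "_ \<Rightarrow> 'v::real_normed_vector"
  assumes "\<And>\<beta>. smooth_on \<Omega> (B \<beta>)" "smooth_on \<Omega> N" "z \<in> jet_domain \<Omega>"
  shows "total_x (lax_y B N l) z = (\<Sum>\<alpha>\<in>UNIV.
    Ux \<alpha> z *\<^sub>R ((\<Sum>\<beta>\<in>UNIV. Uy \<beta> z *\<^sub>R partial_deriv \<alpha> (B \<beta>) (base z)) + (1 / l) *\<^sub>R partial_deriv \<alpha> N (base z))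
    + Uxy \<alpha> z *\<^sub>R B \<alpha> (base z))"
proof -
  have 1: "partial_deriv (0, 0, \<alpha>) (lax_y B N l) z =
      (\<Sum>\<beta>\<in>UNIV. Uy \<beta> z *\<^sub>R partial_deriv \<alpha> (B \<beta>) (base z)) + (1 / l) *\<^sub>R partial_deriv \<alpha> N (base z)" for \<alpha>
  proof (rule partial_derivI)
    show "((\<lambda>t. lax_y B N l (z((0, 0, \<alpha>) := t))) has_vector_derivative
      (\<Sum>\<beta>\<in>UNIV. Uy \<beta> z *\<^sub>R partial_deriv \<alpha> (B \<beta>) (base z)) + (1 / l) *\<^sub>R partial_deriv \<alpha> N (base z))
      (at (z (0, 0, \<alpha>)))"
      unfolding lax_y_def base_upd_base Uy_upd
      by (simp del: fun_upd_apply, intro has_vector_derivative_add has_vector_derivative_sum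
          bounded_linear.has_vector_derivative[OF bounded_linear_scaleR_right]
          has_vector_derivative_base[OF _ assms(3)] assms)
  qed
  have 2: "partial_deriv (0, 1, \<alpha>) (lax_y B N l) z = B \<alpha> (base z)" for \<alpha>
  proof (rule partial_derivI)
    have "((\<lambda>t. (\<Sum>\<beta>\<in>UNIV. (z((0, 1, \<alpha>) := t)) (0, 1, \<beta>) *\<^sub>R B \<beta> (base z)) + (1 / l) *\<^sub>R N (base z))
      has_vector_derivative (\<Sum>\<beta>\<in>UNIV. (if (0 :: nat, 1 :: nat, \<beta>) = (0, 1, \<alpha>) then 1 else 0) *\<^sub>R B \<beta> (base z)) + 0)
      (at (z (0, 1, \<alpha>)))"
      by (intro has_vector_derivative_add has_vector_derivative_sum has_vector_derivative_const
          bounded_linear.has_vector_derivative[OF bounded_linear_scaleR_left]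
          has_vector_derivative_coordinate)
    then show "((\<lambda>t. lax_y B N l (z((0, 1, \<alpha>) := t))) has_vector_derivative B \<alpha> (base z))
      (at (z (0, 1, \<alpha>)))"
      unfolding lax_y_def Uy_def
      using sum_delta_scaleR[of \<alpha> "\<lambda>\<beta>. B \<beta> (base z)"]
      by (simp add: base_upd_other eq_commute[of _ \<alpha>] cong: if_cong del: fun_upd_apply)
  qed
  have 3: "partial_deriv (i, j, \<alpha>) (lax_y B N l) z = 0" if "(i, j) \<noteq> (0, 0)" "(i, j) \<noteq> (0, 1)" for i j \<alpha>
    using that by (intro partial_deriv_eq_0) (auto simp: lax_y_def base_upd_other Uy_upd)
  have "total_x (lax_y B N l) z = (\<Sum>\<alpha>\<in>UNIV.
      Ux \<alpha> z *\<^sub>R partial_deriv (0, 0, \<alpha>) (lax_y B N l) z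
      + Uxy \<alpha> z *\<^sub>R partial_deriv (0, 1, \<alpha>) (lax_y B N l) z)"
    by (rule total_x_eq) (rule 3)
  then show ?thesis
    unfolding 1 2 .
qed

section \<open>Cosymmetries from quadratic densities\<close>

text \<open>The hypothesis \<open>deriv\<close> says that the tensor \<open>h\<close> is parallel
  for the connection with coefficients \<open>G\<close>. Thus the \<open>Uy\<close> terms in the
  total derivative of the quadratic density are the \<open>G\<close> terms of \<open>Delta\<close>,
  while the \<open>Uxy\<close> terms come from differentiating the squares.\<close>

lemma quadratic_cosymmetry:
  fixes h :: "'n::finite \<Rightarrow> 'n \<Rightarrow> ('n \<Rightarrow> real) \<Rightarrow> 's::real_normed_vector"
  assumes \<Omega>: "open \<Omega>"
    and smooth: "\<And>\<beta> \<gamma>. smooth_on \<Omega> (h \<beta> \<gamma>)"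
    and sym: "\<And>\<beta> \<gamma> u. u \<in> \<Omega> \<Longrightarrow> h \<beta> \<gamma> u = h \<gamma> \<beta> u"
    and deriv: "\<And>\<alpha> \<beta> \<gamma> u. u \<in> \<Omega> \<Longrightarrow> partial_deriv \<alpha> (h \<beta> \<gamma>) u =
      (\<Sum>\<delta>\<in>UNIV. G \<delta> \<beta> \<alpha> u *\<^sub>R h \<delta> \<gamma> u + G \<delta> \<gamma> \<alpha> u *\<^sub>R h \<beta> \<delta> u)"
  shows "first_order_cosymmetry \<Omega> G (\<lambda>\<alpha> z. \<Sum>\<beta>\<in>UNIV. Ux \<beta> z *\<^sub>R h \<alpha> \<beta> (base z))"
proof -
  note D = open_jet_domain[OF \<Omega>]
  have Ux: "smooth_on (jet_domain \<Omega>) (Ux \<beta>)" for \<beta>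
    unfolding Ux_def by (rule smooth_on_coordinate[OF D])
  \<comment> \<open>Stated for an arbitrary function of the pair (\<open>U_x\<close>,
    \<open>U\<close>), so that it serves both the characteristic and the density.\<close>
  have dep: "depends_up_to_order 1 \<Omega> (\<lambda>z. F (\<lambda>\<beta>. Ux \<beta> z) (base z))" for F :: "_ \<Rightarrow> _ \<Rightarrow> 's"
    unfolding depends_up_to_order_def
  proof (intro ballI impI)
    fix z w :: "'n jet"
    assume "\<forall>i j \<alpha>. i + j \<le> 1 \<longrightarrow> z (i, j, \<alpha>) = w (i, j, \<alpha>)"
    then have "(\<lambda>\<beta>. Ux \<beta> z) = (\<lambda>\<beta>. Ux \<beta> w)" "base z = base w"
      by (auto simp: Ux_def base_def)
    then show "F (\<lambda>\<beta>. Ux \<beta> z) (base z) = F (\<lambda>\<beta>. Ux \<beta> w) (base w)" by simp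
  qed
  let ?R = "\<lambda>\<alpha> z. \<Sum>\<beta>\<in>UNIV. Ux \<beta> z *\<^sub>R h \<alpha> \<beta> (base z)"
  \<comment> \<open>The factor 1/2 compensates for each \<open>Ux \<alpha>\<close> occurring in both
    slots of the symmetric \<open>h\<close>.\<close>
  define L where "L z = (\<Sum>\<beta>\<in>UNIV. \<Sum>\<gamma>\<in>UNIV. ((1 / 2) * (Ux \<beta> z * Ux \<gamma> z)) *\<^sub>R h \<beta> \<gamma> (base z))" for z
  have R1: "depends_up_to_order 1 \<Omega> (?R \<alpha>)" for \<alpha>
    by (rule dep[of "\<lambda>v u. \<Sum>\<beta>\<in>UNIV. v \<beta> *\<^sub>R h \<alpha> \<beta> u"])
  have R: "differential_function \<Omega> (?R \<alpha>)" for \<alpha>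
    unfolding differential_function_def
    using R1 by (auto intro!: smooth_on_sum D smooth_on_bilinear[OF _ bounded_bilinear_scaleR] Ux
        smooth_on_base \<Omega> smooth)
  have "depends_up_to_order 1 \<Omega> L"
    unfolding L_def by (rule dep[of "\<lambda>v u. \<Sum>\<beta>\<in>UNIV. \<Sum>\<gamma>\<in>UNIV. ((1 / 2) * (v \<beta> * v \<gamma>)) *\<^sub>R h \<beta> \<gamma> u"])
  moreover have "smooth_on (jet_domain \<Omega>) L"
    unfolding L_def
    by (intro smooth_on_sum D smooth_on_bilinear[OF _ bounded_bilinear_scaleR]
        smooth_on_bilinear[OF _ bounded_bilinear_mult] smooth_on_const Ux smooth_on_base \<Omega> smooth)
  ultimately have L: "differential_function \<Omega> L"
    unfolding differential_function_def by blast
  have zero: "differential_function \<Omega> (\<lambda>z. 0 :: 's)"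
    unfolding differential_function_def depends_up_to_order_def by (auto intro: smooth_on_const)
  have eq: "total_x (\<lambda>z. 0 :: 's) z + total_y L z = (\<Sum>\<alpha>\<in>UNIV. Delta G \<alpha> z *\<^sub>R ?R \<alpha> z)"
    if z: "z \<in> jet_domain \<Omega>" for z
  proof -
    have u: "base z \<in> \<Omega>" using z by (simp add: jet_domain_def)
    have 1: "partial_deriv (0, 0, \<alpha>) L z =
        (\<Sum>\<beta>\<in>UNIV. \<Sum>\<gamma>\<in>UNIV. ((1 / 2) * (Ux \<beta> z * Ux \<gamma> z)) *\<^sub>R partial_deriv \<alpha> (h \<beta> \<gamma>) (base z))" for \<alpha>
    proof (rule partial_derivI)
      show "((\<lambda>t. L (z((0, 0, \<alpha>) := t))) has_vector_derivative
        (\<Sum>\<beta>\<in>UNIV. \<Sum>\<gamma>\<in>UNIV. ((1 / 2) * (Ux \<beta> z * Ux \<gamma> z)) *\<^sub>R partial_deriv \<alpha> (h \<beta> \<gamma>) (base z)))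
        (at (z (0, 0, \<alpha>)))"
        unfolding L_def base_upd_base Ux_upd
        by (simp del: fun_upd_apply, intro has_vector_derivative_sum
            bounded_linear.has_vector_derivative[OF bounded_linear_scaleR_right]
            has_vector_derivative_base[OF _ z] smooth)
    qed
    have 2: "partial_deriv (1, 0, \<alpha>) L z = ?R \<alpha> z" for \<alpha>
    proof (rule partial_derivI)
      \<comment> \<open>\<open>?e\<close> is the derivative of the coordinate
        \<open>(1, 0, \<beta>)\<close> along \<open>(1, 0, \<alpha>)\<close>. The updates of
        \<open>z\<close> by its own value below are just \<open>z\<close>, in the shape that the
        product rule leaves.\<close>
      let ?e = "\<lambda>\<beta>. if (1 :: nat, 0 :: nat, \<beta>) = (1, 0, \<alpha>) then 1 else 0 :: real"
      have "((\<lambda>t. \<Sum>\<beta>\<in>UNIV. \<Sum>\<gamma>\<in>UNIV.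
            ((1 / 2) * ((z((1, 0, \<alpha>) := t)) (1, 0, \<beta>) * (z((1, 0, \<alpha>) := t)) (1, 0, \<gamma>))) *\<^sub>R h \<beta> \<gamma> (base z))
          has_vector_derivative (\<Sum>\<beta>\<in>UNIV. \<Sum>\<gamma>\<in>UNIV. ((1 / 2) *
            ((z((1, 0, \<alpha>) := z (1, 0, \<alpha>))) (1, 0, \<beta>) * ?e \<gamma> + ?e \<beta> * (z((1, 0, \<alpha>) := z (1, 0, \<alpha>))) (1, 0, \<gamma>)))
            *\<^sub>R h \<beta> \<gamma> (base z)))
          (at (z (1, 0, \<alpha>)))"
        by (intro has_vector_derivative_sum
            bounded_linear.has_vector_derivative[OF bounded_linear_scaleR_left]
            bounded_linear.has_vector_derivative[OF bounded_linear_mult_right]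
            bounded_bilinear.has_vector_derivative[OF bounded_bilinear_mult]
            has_vector_derivative_coordinate)
      also have "(\<Sum>\<beta>\<in>UNIV. \<Sum>\<gamma>\<in>UNIV. ((1 / 2) *
            ((z((1, 0, \<alpha>) := z (1, 0, \<alpha>))) (1, 0, \<beta>) * ?e \<gamma> + ?e \<beta> * (z((1, 0, \<alpha>) := z (1, 0, \<alpha>))) (1, 0, \<gamma>)))
            *\<^sub>R h \<beta> \<gamma> (base z)) =
          (\<Sum>\<beta>\<in>UNIV. \<Sum>\<gamma>\<in>UNIV. (if \<alpha> = \<gamma> then 1 else 0) *\<^sub>R (((1 / 2) * Ux \<beta> z) *\<^sub>R h \<beta> \<gamma> (base z)))
          + (\<Sum>\<beta>\<in>UNIV. (if \<alpha> = \<beta> then 1 else 0) *\<^sub>R (\<Sum>\<gamma>\<in>UNIV. ((1 / 2) * Ux \<gamma> z) *\<^sub>R h \<beta> \<gamma> (base z)))"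
        unfolding scaleR_sum_right sum.distrib[symmetric]
        by (intro sum.cong refl) (auto simp: Ux_def algebra_simps)
      \<comment> \<open>Symmetry of \<open>h\<close> makes the two half contributions equal.\<close>
      also have "\<dots> = ?R \<alpha> z"
        unfolding sum_delta_scaleR sum.distrib[symmetric]
        by (intro sum.cong refl) (simp add: sym[OF u, of _ \<alpha>] scaleR_left_distrib[symmetric])
      finally show "((\<lambda>t. L (z((1, 0, \<alpha>) := t))) has_vector_derivative ?R \<alpha> z) (at (z (1, 0, \<alpha>)))"
        unfolding L_def Ux_def by (simp add: base_upd_other del: fun_upd_apply)
    qed
    have 3: "partial_deriv (i, j, \<alpha>) L z = 0" if "(i, j) \<noteq> (0, 0)" "(i, j) \<noteq> (1, 0)" for i j \<alpha>
      using that by (intro partial_deriv_eq_0) (auto simp: L_def base_upd_other Ux_upd)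
    have half: "(\<Sum>\<beta>\<in>UNIV. \<Sum>\<gamma>\<in>UNIV. ((1 / 2) * (Ux \<beta> z * Ux \<gamma> z)) *\<^sub>R partial_deriv \<alpha> (h \<beta> \<gamma>) (base z))
        = (\<Sum>\<delta>\<in>UNIV. \<Sum>\<beta>\<in>UNIV. (G \<delta> \<beta> \<alpha> (base z) * Ux \<beta> z) *\<^sub>R ?R \<delta> z)" for \<alpha>
    proof -
      \<comment> \<open>\<open>?t \<beta> \<gamma> \<delta>\<close> is the first term of
        \<open>deriv\<close> with its weight; by symmetry of \<open>h\<close> the second term is
        \<open>?t \<gamma> \<beta> \<delta>\<close>. Renaming the summation indices merges the two
        halves.\<close>
      let ?t = "\<lambda>\<beta> \<gamma> \<delta>. ((1 / 2) * (Ux \<beta> z * Ux \<gamma> z) * G \<delta> \<beta> \<alpha> (base z)) *\<^sub>R h \<delta> \<gamma> (base z)"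
      have "(\<Sum>\<beta>\<in>UNIV. \<Sum>\<gamma>\<in>UNIV. ((1 / 2) * (Ux \<beta> z * Ux \<gamma> z)) *\<^sub>R partial_deriv \<alpha> (h \<beta> \<gamma>) (base z))
        = (\<Sum>\<beta>\<in>UNIV. \<Sum>\<gamma>\<in>UNIV. \<Sum>\<delta>\<in>UNIV. ?t \<beta> \<gamma> \<delta> + ?t \<gamma> \<beta> \<delta>)"
        unfolding deriv[OF u] scaleR_sum_right
        by (intro sum.cong refl) (simp add: scaleR_add_right sym[OF u] mult.commute)
      also have "\<dots> = (\<Sum>\<beta>\<in>UNIV. \<Sum>\<gamma>\<in>UNIV. \<Sum>\<delta>\<in>UNIV. ?t \<beta> \<gamma> \<delta>) + (\<Sum>\<gamma>\<in>UNIV. \<Sum>\<beta>\<in>UNIV. \<Sum>\<delta>\<in>UNIV. ?t \<gamma> \<beta> \<delta>)"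
        unfolding sum.distrib by (rule arg_cong2[where f = "(+)", OF refl sum.swap])
      also have "\<dots> = (\<Sum>\<beta>\<in>UNIV. \<Sum>\<gamma>\<in>UNIV. \<Sum>\<delta>\<in>UNIV.
          (G \<delta> \<beta> \<alpha> (base z) * Ux \<beta> z) *\<^sub>R Ux \<gamma> z *\<^sub>R h \<delta> \<gamma> (base z))"
        unfolding sum.distrib[symmetric]
        by (intro sum.cong refl) (simp add: scaleR_left_distrib[symmetric] algebra_simps)
      also have "\<dots> = (\<Sum>\<beta>\<in>UNIV. \<Sum>\<delta>\<in>UNIV. \<Sum>\<gamma>\<in>UNIV.
          (G \<delta> \<beta> \<alpha> (base z) * Ux \<beta> z) *\<^sub>R Ux \<gamma> z *\<^sub>R h \<delta> \<gamma> (base z))"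
        by (intro sum.cong refl sum.swap)
      also have "\<dots> = (\<Sum>\<delta>\<in>UNIV. \<Sum>\<beta>\<in>UNIV. (G \<delta> \<beta> \<alpha> (base z) * Ux \<beta> z) *\<^sub>R ?R \<delta> z)"
        unfolding scaleR_sum_right by (rule sum.swap)
      finally show ?thesis .
    qed
    have "total_y L z = (\<Sum>\<alpha>\<in>UNIV.
        Uy \<alpha> z *\<^sub>R partial_deriv (0, 0, \<alpha>) L z + Uxy \<alpha> z *\<^sub>R partial_deriv (1, 0, \<alpha>) L z)"
      by (rule total_y_eq) (rule 3)
    then have "total_y L z = (\<Sum>\<alpha>\<in>UNIV. Uy \<alpha> z *\<^sub>R (\<Sum>\<delta>\<in>UNIV. \<Sum>\<beta>\<in>UNIV. (G \<delta> \<beta> \<alpha> (base z) * Ux \<beta> z) *\<^sub>R ?R \<delta> z))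
        + (\<Sum>\<alpha>\<in>UNIV. Uxy \<alpha> z *\<^sub>R ?R \<alpha> z)"
      unfolding 1 2 half sum.distrib .
    also have "(\<Sum>\<alpha>\<in>UNIV. Uy \<alpha> z *\<^sub>R (\<Sum>\<delta>\<in>UNIV. \<Sum>\<beta>\<in>UNIV. (G \<delta> \<beta> \<alpha> (base z) * Ux \<beta> z) *\<^sub>R ?R \<delta> z))
        = (\<Sum>\<alpha>\<in>UNIV. \<Sum>\<delta>\<in>UNIV. (\<Sum>\<beta>\<in>UNIV. G \<delta> \<beta> \<alpha> (base z) * Ux \<beta> z * Uy \<alpha> z) *\<^sub>R ?R \<delta> z)"
      by (simp add: scaleR_sum_left[symmetric] scaleR_sum_right[where a = "Uy _ z"] sum_distrib_left mult_ac
          del: scaleR_sum_right)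
    also have "\<dots> = (\<Sum>\<delta>\<in>UNIV. \<Sum>\<alpha>\<in>UNIV. (\<Sum>\<beta>\<in>UNIV. G \<delta> \<beta> \<alpha> (base z) * Ux \<beta> z * Uy \<alpha> z) *\<^sub>R ?R \<delta> z)"
      by (rule sum.swap)
    also have "\<dots> = (\<Sum>\<delta>\<in>UNIV. (\<Sum>\<beta>\<in>UNIV. \<Sum>\<alpha>\<in>UNIV. G \<delta> \<beta> \<alpha> (base z) * Ux \<beta> z * Uy \<alpha> z) *\<^sub>R ?R \<delta> z)"
      unfolding scaleR_sum_left[symmetric] by (subst sum.swap) (rule refl)
    finally have "total_y L z = (\<Sum>\<alpha>\<in>UNIV. Delta G \<alpha> z *\<^sub>R ?R \<alpha> z)"
      unfolding Delta_def scaleR_left_distrib sum.distrib by (simp only: add.commute)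
    moreover have "total_x (\<lambda>z. 0 :: 's) z = 0"
      by (simp add: total_x_def partial_deriv_const split_def)
    ultimately show ?thesis by simp
  qed
  show ?thesis
    unfolding first_order_cosymmetry_def cosymmetry_def
    using R R1 zero L eq by blast
qed

section \<open>The zero-curvature equations\<close>

lemma bounded_bilinear_bracket:
  "bounded_bilinear (bracket :: 'k::{real_normed_field, euclidean_space} ^ 'm ^ 'm \<Rightarrow> _)"
proof -
  have "bilinear (bracket :: 'k ^ 'm ^ 'm \<Rightarrow> _)"
    unfolding bilinear_def
    by (intro conjI allI linearI)
      (simp_all add: bracket_def matrix_matrix_mult_def vec_eq_iff sum.distrib algebra_simps
        scaleR_sum_right sum_subtractf)
  then show ?thesis
    by (simp add: bilinear_conv_bounded_bilinear)
qed

lemmas bracket_add_left = bounded_bilinear.add_left[OF bounded_bilinear_bracket]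
  and bracket_add_right = bounded_bilinear.add_right[OF bounded_bilinear_bracket]
  and bracket_diff_left = bounded_bilinear.diff_left[OF bounded_bilinear_bracket]
  and bracket_scaleR_left = bounded_bilinear.scaleR_left[OF bounded_bilinear_bracket]
  and bracket_scaleR_right = bounded_bilinear.scaleR_right[OF bounded_bilinear_bracket]
  and bracket_sum_left = bounded_bilinear.sum_left[OF bounded_bilinear_bracket]

lemma bracket_anticomm: "bracket X Y = - bracket Y X"
  by (simp add: bracket_def)

lemma bracket_jacobi: "bracket X (bracket Y Z) = bracket (bracket X Y) Z + bracket Y (bracket X Z)"
proof -
  have sub: "P ** (Q - R) = P ** Q - P ** R" "(P - Q) ** R = P ** R - Q ** R"
    for P Q R :: "'a::comm_ring_1 ^ 'b ^ 'b"
    by (simp_all add: matrix_matrix_mult_def vec_eq_iff algebra_simps sum_subtractf)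
  show ?thesis
    by (simp add: bracket_def sub matrix_mul_assoc)
qed

text \<open>Jet coordinates are independent, so over any \<open>u\<close> the values of
  \<open>U_x\<close> and \<open>U_y\<close> can be prescribed as \<open>a\<close> and
  \<open>b\<close>. Taking \<open>U_xy\<close> to be zero leaves an identity in \<open>a\<close>,
  \<open>b\<close> and \<open>l\<close> alone, from which coefficients can be read off.\<close>

lemma lax_representation_first_order:
  fixes A B :: "'n::finite \<Rightarrow> ('n \<Rightarrow> real) \<Rightarrow> 'k::{real_normed_field, euclidean_space} ^ 'm ^ 'm"
  assumes lax: "lax_representation \<Omega> G \<gg> A B M N" and u: "u \<in> \<Omega>" and l: "l \<noteq> 0"
  shows "(\<Sum>\<alpha>\<in>UNIV. b \<alpha> *\<^sub>R ((\<Sum>\<beta>\<in>UNIV. a \<beta> *\<^sub>R partial_deriv \<alpha> (A \<beta>) u) + l *\<^sub>R partial_deriv \<alpha> M u))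
    - (\<Sum>\<alpha>\<in>UNIV. a \<alpha> *\<^sub>R ((\<Sum>\<beta>\<in>UNIV. b \<beta> *\<^sub>R partial_deriv \<alpha> (B \<beta>) u) + (1 / l) *\<^sub>R partial_deriv \<alpha> N u))
    + bracket ((\<Sum>\<alpha>\<in>UNIV. a \<alpha> *\<^sub>R A \<alpha> u) + l *\<^sub>R M u) ((\<Sum>\<alpha>\<in>UNIV. b \<alpha> *\<^sub>R B \<alpha> u) + (1 / l) *\<^sub>R N u)
    = (\<Sum>\<alpha>\<in>UNIV. (\<Sum>\<beta>\<in>UNIV. \<Sum>\<gamma>\<in>UNIV. G \<alpha> \<beta> \<gamma> u * a \<beta> * b \<gamma>) *\<^sub>R char_elem A B \<alpha> u)"
proof -
  define z :: "'n jet" where "z = (\<lambda>(i, j, \<alpha>).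
    if (i, j) = (0, 0) then u \<alpha> else if (i, j) = (1, 0) then a \<alpha> else if (i, j) = (0, 1) then b \<alpha> else 0)"
  have z: "base z = u" "Ux \<alpha> z = a \<alpha>" "Uy \<alpha> z = b \<alpha>" "Uxy \<alpha> z = 0" for \<alpha>
    by (auto simp: z_def base_def Ux_def Uy_def Uxy_def)
  have zD: "z \<in> jet_domain \<Omega>"
    using u by (simp add: jet_domain_def z)
  have "smooth_on \<Omega> (A \<beta>)" "smooth_on \<Omega> (B \<beta>)" "smooth_on \<Omega> M" "smooth_on \<Omega> N" for \<beta>
    using lax unfolding lax_representation_def by blast+
  note total = total_y_lax_x[of \<Omega> A M z l, OF this(1,3) zD] total_x_lax_y[of \<Omega> B N z l, OF this(2,4) zD]
  have "total_y (lax_x A M l) z - total_x (lax_y B N l) z + bracket (lax_x A M l z) (lax_y B N l z)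
        = (\<Sum>\<alpha>\<in>UNIV. Delta G \<alpha> z *\<^sub>R char_elem A B \<alpha> (base z))"
    using lax l zD unfolding lax_representation_def by blast
  then show ?thesis
    unfolding total lax_x_def lax_y_def Delta_def z by simp
qed

text \<open>With \<open>U_x\<close> zero and \<open>U_y\<close> a unit vector, the curvature
  identity has a part linear in \<open>l\<close> and a part constant in \<open>l\<close>. The values
  at \<open>l = 1\<close> and \<open>l = - 1\<close> separate them.\<close>

lemma lax_partial_deriv_M:
  fixes A B :: "'n::finite \<Rightarrow> ('n \<Rightarrow> real) \<Rightarrow> 'k::{real_normed_field, euclidean_space} ^ 'm ^ 'm"
  assumes "lax_representation \<Omega> G \<gg> A B M N" "u \<in> \<Omega>"
  shows "partial_deriv \<gamma> M u = bracket (B \<gamma> u) (M u)" "bracket (M u) (N u) = 0"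
proof -
  have eq: "l *\<^sub>R (partial_deriv \<gamma> M u + bracket (M u) (B \<gamma> u)) + bracket (M u) (N u) = 0" if "l \<noteq> 0" for l
    using lax_representation_first_order[OF assms that, of "\<lambda>\<alpha>. if \<gamma> = \<alpha> then 1 else 0" "\<lambda>_. 0",
        unfolded sum_delta_scaleR] that
    by (simp add: bracket_scaleR_left bracket_add_right bracket_scaleR_right
        scaleR_add_right add.assoc)
  have "2 *\<^sub>R bracket (M u) (N u) = 0"
    using arg_cong2[where f = "(+)", OF eq[of 1] eq[of "- 1"]] by (simp add: scaleR_2 algebra_simps)
  then show MN: "bracket (M u) (N u) = 0"
    by simp
  then show "partial_deriv \<gamma> M u = bracket (B \<gamma> u) (M u)"
    unfolding bracket_anticomm[of "B \<gamma> u" "M u"] using eq[of 1] by (simp add: eq_neg_iff_add_eq_0)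
qed

text \<open>This is the part of degree zero in \<open>l\<close> of the curvature identity for unit
  vectors \<open>U_x\<close> and \<open>U_y\<close>. The term \<open>[M, N]\<close>, also of degree
  zero, has already been shown to vanish.\<close>

lemma lax_partial_deriv_A:
  fixes A B :: "'n::finite \<Rightarrow> ('n \<Rightarrow> real) \<Rightarrow> 'k::{real_normed_field, euclidean_space} ^ 'm ^ 'm"
  assumes "lax_representation \<Omega> G \<gg> A B M N" "u \<in> \<Omega>"
  shows "partial_deriv \<gamma> (A \<alpha>) u - partial_deriv \<alpha> (B \<gamma>) u + bracket (A \<alpha> u) (B \<gamma> u)
    = (\<Sum>\<delta>\<in>UNIV. G \<delta> \<alpha> \<gamma> u *\<^sub>R char_elem A B \<delta> u)"
proof -
  define R where "R = (\<Sum>\<delta>\<in>UNIV. G \<delta> \<alpha> \<gamma> u *\<^sub>R char_elem A B \<delta> u)"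
  define P where "P = partial_deriv \<gamma> (A \<alpha>) u - partial_deriv \<alpha> (B \<gamma>) u + bracket (A \<alpha> u) (B \<gamma> u)"
  \<comment> \<open>\<open>Q\<close> collects all terms odd in \<open>l\<close>; adding the
    identities for \<open>l = 1\<close> and \<open>l = - 1\<close> removes it.\<close>
  define Q where "Q l = l *\<^sub>R partial_deriv \<gamma> M u + l *\<^sub>R bracket (M u) (B \<gamma> u)
    + (1 / l) *\<^sub>R bracket (A \<alpha> u) (N u) - (1 / l) *\<^sub>R partial_deriv \<alpha> N u" for l :: real
  have eq: "P + Q l = R" if "l \<noteq> 0" for l
  proof -
    have "(\<Sum>\<beta>\<in>UNIV. \<Sum>\<gamma>'\<in>UNIV. G \<delta> \<beta> \<gamma>' u * (if \<alpha> = \<beta> then 1 else 0) * (if \<gamma> = \<gamma>' then 1 else 0))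
        = G \<delta> \<alpha> \<gamma> u" for \<delta>
      by (simp add: if_distrib[of "\<lambda>x. _ * x"] cong: if_cong)
    from lax_representation_first_order[OF assms that, of "\<lambda>\<delta>. if \<gamma> = \<delta> then 1 else 0"
          "\<lambda>\<delta>. if \<alpha> = \<delta> then 1 else 0", unfolded sum_delta_scaleR this]
    show ?thesis
      unfolding P_def Q_def R_def
      by (simp add: bracket_add_left bracket_scaleR_left bracket_add_right bracket_scaleR_right
          lax_partial_deriv_M(2)[OF assms] that algebra_simps)
  qed
  have "Q (- 1) = - Q 1"
    by (simp add: Q_def algebra_simps)
  then have "2 *\<^sub>R P = 2 *\<^sub>R R"
    using arg_cong2[where f = "(+)", OF eq[of 1] eq[of "- 1"]] by (simp add: scaleR_2)
  then show ?thesis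
    by (simp add: P_def R_def)
qed

lemma partial_deriv_bracket:
  fixes X Y :: "('n \<Rightarrow> real) \<Rightarrow> 'k::{real_normed_field, euclidean_space} ^ 'm ^ 'm"
  assumes "smooth_on \<Omega> X" "smooth_on \<Omega> Y" "u \<in> \<Omega>"
  shows "partial_deriv \<gamma> (\<lambda>u. bracket (X u) (Y u)) u
    = bracket (partial_deriv \<gamma> X u) (Y u) + bracket (X u) (partial_deriv \<gamma> Y u)"
  by (rule partial_derivI[OF has_vector_derivative_slice_bilinear[OF bounded_bilinear_bracket
          smooth_on_has_partial_deriv[OF assms(1,3)] smooth_on_has_partial_deriv[OF assms(2,3)]]])

text \<open>Comparing the two mixed derivatives of \<open>M\<close> turns \<open>\<partial>\<^sub>\<alpha> B\<^sub>\<gamma>\<close> in the zero-curvature equation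
  into \<open>\<partial>\<^sub>\<gamma> B\<^sub>\<alpha>\<close>, up to elements commuting with \<open>M\<close>.\<close>

lemma lax_partial_deriv_bracket_M:
  fixes A B :: "'n::finite \<Rightarrow> ('n \<Rightarrow> real) \<Rightarrow> 'k::{real_normed_field, euclidean_space} ^ 'm ^ 'm"
  assumes \<Omega>: "open \<Omega>" and lax: "lax_representation \<Omega> G \<gg> A B M N" and u: "u \<in> \<Omega>"
  defines "X \<equiv> \<lambda>\<alpha> u. bracket (char_elem A B \<alpha> u) (M u)"
  shows "partial_deriv \<gamma> (X \<alpha>) u
    = (\<Sum>\<delta>\<in>UNIV. G \<delta> \<alpha> \<gamma> u *\<^sub>R X \<delta> u) + bracket (B \<gamma> u) (X \<alpha> u)"
proof -
  have sm: "smooth_on \<Omega> (A \<beta>)" "smooth_on \<Omega> (B \<beta>)" "smooth_on \<Omega> M" for \<beta>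
    using lax unfolding lax_representation_def by blast+
  note dM = lax_partial_deriv_M(1)[OF lax]
  have mixed: "partial_deriv \<gamma> (partial_deriv \<alpha> M) u
      = bracket (partial_deriv \<gamma> (B \<alpha>) u) (M u) + bracket (B \<alpha> u) (bracket (B \<gamma> u) (M u))" for \<alpha> \<gamma>
  proof -
    have "partial_deriv \<gamma> (partial_deriv \<alpha> M) u = partial_deriv \<gamma> (\<lambda>u. bracket (B \<alpha> u) (M u)) u"
      \<comment> \<open>The formula for the derivative of \<open>M\<close> holds on all of the open
        set \<open>\<Omega>\<close>, so it may be differentiated once more.\<close>
      by (rule partial_deriv_cong[OF \<Omega> u dM])
    then show ?thesis
      by (simp add: partial_deriv_bracket[OF sm(2,3) u] dM[OF u])
  qed
  have "partial_deriv \<gamma> (partial_deriv \<alpha> M) u = partial_deriv \<alpha> (partial_deriv \<gamma> M) u"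
    by (rule partial_deriv_commute[OF \<Omega> sm(3) u])
  then have BB: "bracket (partial_deriv \<gamma> (B \<alpha>) u) (M u)
      = bracket (partial_deriv \<alpha> (B \<gamma>) u) (M u) - bracket (bracket (B \<alpha> u) (B \<gamma> u)) (M u)"
    unfolding mixed bracket_jacobi[of "B \<alpha> u"] by (simp add: algebra_simps)
  have "partial_deriv \<gamma> (A \<alpha>) u = (\<Sum>\<delta>\<in>UNIV. G \<delta> \<alpha> \<gamma> u *\<^sub>R char_elem A B \<delta> u)
      + partial_deriv \<alpha> (B \<gamma>) u - bracket (A \<alpha> u) (B \<gamma> u)"
    using lax_partial_deriv_A[OF lax u, of \<gamma> \<alpha>] by (simp add: algebra_simps)
  then have AM: "bracket (partial_deriv \<gamma> (A \<alpha>) u) (M u) = (\<Sum>\<delta>\<in>UNIV. G \<delta> \<alpha> \<gamma> u *\<^sub>R X \<delta> u)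
      + bracket (partial_deriv \<alpha> (B \<gamma>) u) (M u) - bracket (bracket (A \<alpha> u) (B \<gamma> u)) (M u)"
    by (simp add: X_def bracket_add_left bracket_diff_left bracket_sum_left bracket_scaleR_left)
  have S: "smooth_on \<Omega> (char_elem A B \<alpha>)"
    unfolding char_elem_def by (intro smooth_on_diff \<Omega> sm)
  have dS: "partial_deriv \<gamma> (char_elem A B \<alpha>) u = partial_deriv \<gamma> (A \<alpha>) u - partial_deriv \<gamma> (B \<alpha>) u"
    unfolding char_elem_def
    by (rule partial_derivI[OF has_vector_derivative_diff[OF smooth_on_has_partial_deriv[OF sm(1) u]
            smooth_on_has_partial_deriv[OF sm(2) u]]])
  have "partial_deriv \<gamma> (X \<alpha>) u = bracket (partial_deriv \<gamma> (A \<alpha>) u) (M u)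
      - bracket (partial_deriv \<gamma> (B \<alpha>) u) (M u) + bracket (char_elem A B \<alpha> u) (bracket (B \<gamma> u) (M u))"
    unfolding X_def by (simp add: partial_deriv_bracket[OF S sm(3) u] dS dM[OF u] bracket_diff_left)
  \<comment> \<open>The terms with the derivative of \<open>B \<gamma>\<close> cancel between
    \<open>AM\<close> and \<open>BB\<close>, and the double brackets with \<open>A \<alpha>\<close>
    and \<open>B \<alpha>\<close> merge into one with their difference. The Jacobi identity then
    absorbs it.\<close>
  also have "\<dots> = (\<Sum>\<delta>\<in>UNIV. G \<delta> \<alpha> \<gamma> u *\<^sub>R X \<delta> u) - bracket (bracket (char_elem A B \<alpha> u) (B \<gamma> u)) (M u)
      + bracket (char_elem A B \<alpha> u) (bracket (B \<gamma> u) (M u))"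
    unfolding AM BB by (simp add: char_elem_def bracket_diff_left)
  also have "\<dots> = (\<Sum>\<delta>\<in>UNIV. G \<delta> \<alpha> \<gamma> u *\<^sub>R X \<delta> u) + bracket (B \<gamma> u) (X \<alpha> u)"
    unfolding X_def bracket_jacobi[of "char_elem A B \<alpha> u"] by simp
  finally show ?thesis .
qed

section \<open>Derivatives of invariant forms\<close>

lemma multilinear_sum_scaleR:
  assumes "multilinear p g" "length Xs = p" "i < p"
  shows "g (Xs[i := (\<Sum>j\<in>J. c j *\<^sub>R X j)]) = (\<Sum>j\<in>J. c j *\<^sub>R g (Xs[i := X j]))"
proof -
  have l: "linear (\<lambda>X. g (Xs[i := X]))"
    using assms by (simp add: multilinear_def)
  show ?thesis
    using linear_sum[OF l, of "\<lambda>j. c j *\<^sub>R X j" J] by (simp add: linear_scale[OF l])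
qed

text \<open>The Leibniz rule splits each slot into its \<open>Ws\<close> part and its
  \<open>ad Y\<close> part, and invariance cancels the sum of the latter. Invariance is required
  only for the values at \<open>u\<close>, because the \<open>g\<close> used later is an extension
  whose invariance is known only for arguments in the Lie algebra.\<close>

lemma partial_deriv_invariant_form:
  fixes Fs :: "(('n \<Rightarrow> real) \<Rightarrow> 'k::{real_normed_field, euclidean_space} ^ 'm ^ 'm) list"
    and g :: "_ \<Rightarrow> 's::real_normed_vector"
  assumes "multilinear (length Fs) g" "\<And>F. F \<in> set Fs \<Longrightarrow> smooth_on \<Omega> F" "u \<in> \<Omega>"
    and inv: "(\<Sum>i<length Fs. g ((map (\<lambda>F. F u) Fs)[i := bracket Y ((map (\<lambda>F. F u) Fs) ! i)])) = 0"
    and W: "length Ws = length Fs"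
      "\<And>i. i < length Fs \<Longrightarrow> partial_deriv \<gamma> (Fs ! i) u = Ws ! i + bracket Y ((Fs ! i) u)"
  shows "partial_deriv \<gamma> (\<lambda>u. g (map (\<lambda>F. F u) Fs)) u
    = (\<Sum>i<length Fs. g ((map (\<lambda>F. F u) Fs)[i := Ws ! i]))"
proof -
  let ?Xs = "map (\<lambda>F. F u) Fs"
  have g: "multilinear (length (map (\<lambda>F t. F (u(\<gamma> := t))) Fs)) g"
    using assms(1) by simp
  have l: "linear (\<lambda>X. g (?Xs[i := X]))" if "i < length Fs" for i
    using assms(1) that by (simp add: multilinear_def)
  have "list_all2 (\<lambda>F F'. (F has_vector_derivative F') (at (u \<gamma>)))
      (map (\<lambda>F t. F (u(\<gamma> := t))) Fs) (map (\<lambda>F. partial_deriv \<gamma> F u) Fs)"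
    using assms(2,3) by (auto simp: list_all2_conv_all_nth intro!: smooth_on_has_partial_deriv simp del: fun_upd_apply)
  from has_vector_derivative_multilinear[OF g this]
  have "partial_deriv \<gamma> (\<lambda>u. g (map (\<lambda>F. F u) Fs)) u
      = (\<Sum>i<length Fs. g (?Xs[i := map (\<lambda>F. partial_deriv \<gamma> F u) Fs ! i]))"
    by (intro partial_derivI) (simp add: comp_def del: fun_upd_apply)
  also have "\<dots> = (\<Sum>i<length Fs. g (?Xs[i := Ws ! i]) + g (?Xs[i := bracket Y (?Xs ! i)]))"
    by (intro sum.cong refl) (simp add: W(2) linear_add[OF l])
  finally show ?thesis
    using inv by (simp add: sum.distrib)
qed

theorem corollary1:
  fixes \<Omega> :: "('n::finite \<Rightarrow> real) set"
    and G :: "'n \<Rightarrow> 'n \<Rightarrow> 'n \<Rightarrow> ('n \<Rightarrow> real) \<Rightarrow> real"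
    and \<gg> :: "('k::{real_normed_field, euclidean_space} ^ 'm ^ 'm) set"
    and A B :: "'n \<Rightarrow> ('n \<Rightarrow> real) \<Rightarrow> 'k ^ 'm ^ 'm"
    and M N :: "('n \<Rightarrow> real) \<Rightarrow> 'k ^ 'm ^ 'm"
    and p :: nat
    and f :: "('k ^ 'm ^ 'm) list \<Rightarrow> 's::real_normed_field"
  assumes "open \<Omega>"
    and "\<forall>\<alpha> \<beta> \<gamma>. smooth_on \<Omega> (G \<alpha> \<beta> \<gamma>)"
    and "matrix_lie_algebra \<gg>"
    and "lax_representation \<Omega> G \<gg> A B M N"
    and "p \<ge> 2"
    and "symmetric_form \<gg> p f"
    and "ad_invariant \<gg> p f"
  shows "first_order_cosymmetry \<Omega> G
    (\<lambda>\<alpha> z. let u = base z; S = char_elem A B in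
      \<Sum>\<beta>\<in>UNIV. Ux \<beta> z *\<^sub>R
        f (bracket (S \<alpha> u) (M u) # bracket (S \<beta> u) (M u) # replicate (p - 2) (M u)))"
proof -
  note \<Omega> = assms(1) and lie = assms(3) and lax = assms(4) and sym = assms(6) and ad = assms(7)
  obtain q where p: "p = Suc (Suc q)"
    using assms(5) by (metis add_2_eq_Suc le_Suc_ex)
  define X where "X = (\<lambda>\<alpha> u. bracket (char_elem A B \<alpha> u) (M u))"
  define h where "h \<alpha> \<beta> u = f (X \<alpha> u # X \<beta> u # replicate q (M u))" for \<alpha> \<beta> u
  have sm: "smooth_on \<Omega> (A \<beta>)" "smooth_on \<Omega> (B \<beta>)" "smooth_on \<Omega> M" for \<beta>
    using lax unfolding lax_representation_def by blast+
  have X_smooth: "smooth_on \<Omega> (X \<alpha>)" for \<alpha>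
    unfolding X_def char_elem_def
    by (intro smooth_on_bilinear[OF _ bounded_bilinear_bracket] smooth_on_diff \<Omega> sm)
  have mem: "A \<alpha> u \<in> \<gg>" "B \<alpha> u \<in> \<gg>" "M u \<in> \<gg>" if "u \<in> \<Omega>" for \<alpha> u
    using lax that unfolding lax_representation_def by blast+
  have X_mem: "X \<alpha> u \<in> \<gg>" if "u \<in> \<Omega>" for \<alpha> u
    unfolding X_def char_elem_def
    using lie mem[OF that] by (simp add: matrix_lie_algebra_def subspace_diff)
  \<comment> \<open>The calculus is done with the extension \<open>g\<close>; symmetry and
    invariance are taken from \<open>f\<close>.\<close>
  obtain g where g: "multilinear p g" "\<And>Xs. length Xs = p \<Longrightarrow> set Xs \<subseteq> \<gg> \<Longrightarrow> g Xs = f Xs"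
    using symmetric_form_extend[OF _ sym] lie unfolding matrix_lie_algebra_def by blast
  define Fs where "Fs \<alpha> \<beta> = X \<alpha> # X \<beta> # replicate q M" for \<alpha> \<beta>
  have len: "length (Fs \<alpha> \<beta>) = p" for \<alpha> \<beta>
    by (simp add: Fs_def p)
  have Fs_smooth: "smooth_on \<Omega> F" if "F \<in> set (Fs \<alpha> \<beta>)" for F \<alpha> \<beta>
    using that X_smooth sm(3) by (auto simp: Fs_def split: if_splits)
  have Fs_map: "map (\<lambda>F. F u) (Fs \<alpha> \<beta>) = X \<alpha> u # X \<beta> u # replicate q (M u)" for \<alpha> \<beta> u
    by (simp add: Fs_def)
  have Fs_mem: "set (map (\<lambda>F. F u) (Fs \<alpha> \<beta>)) \<subseteq> \<gg>" if "u \<in> \<Omega>" for \<alpha> \<beta> u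
    unfolding Fs_map using X_mem[OF that] mem(3)[OF that] by auto
  \<comment> \<open>This is restricted to \<open>\<Omega>\<close>, where the arguments are known to
    lie in \<open>\<gg>\<close>. Smoothness and derivatives pass between \<open>h\<close> and
    \<open>g\<close> by congruence on the open set \<open>\<Omega>\<close>.\<close>
  have h_eq: "h \<alpha> \<beta> u = g (map (\<lambda>F. F u) (Fs \<alpha> \<beta>))" if "u \<in> \<Omega>" for \<alpha> \<beta> u
    using g(2)[OF _ Fs_mem[OF that, of \<alpha> \<beta>]] by (simp add: len h_def Fs_map p)
  have "first_order_cosymmetry \<Omega> G (\<lambda>\<alpha> z. \<Sum>\<beta>\<in>UNIV. Ux \<beta> z *\<^sub>R h \<alpha> \<beta> (base z))"
  proof (rule quadratic_cosymmetry[OF \<Omega>])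
    show "smooth_on \<Omega> (h \<beta> \<gamma>)" for \<beta> \<gamma>
    proof (rule smooth_on_cong[OF \<Omega>])
      show "smooth_on \<Omega> (\<lambda>u. g (map (\<lambda>F. F u) (Fs \<beta> \<gamma>)))"
        by (rule smooth_on_multilinear[OF \<Omega> _ Fs_smooth]) (simp add: len g(1))
    qed (rule h_eq[symmetric])
    show "h \<beta> \<gamma> u = h \<gamma> \<beta> u" if "u \<in> \<Omega>" for \<beta> \<gamma> u
    proof -
      have "mset (X \<beta> u # X \<gamma> u # replicate q (M u)) = mset (X \<gamma> u # X \<beta> u # replicate q (M u))"
        by simp
      moreover have "length (X \<gamma> u # X \<beta> u # replicate q (M u)) = p"
        by (simp add: p)
      ultimately show ?thesis
        using sym Fs_mem[OF that, of \<gamma> \<beta>] unfolding h_def symmetric_form_def Fs_map by blast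
    qed
    show "partial_deriv \<gamma> (h \<alpha> \<beta>) u =
        (\<Sum>\<delta>\<in>UNIV. G \<delta> \<alpha> \<gamma> u *\<^sub>R h \<delta> \<beta> u + G \<delta> \<beta> \<gamma> u *\<^sub>R h \<alpha> \<delta> u)" if u: "u \<in> \<Omega>" for \<alpha> \<beta> \<gamma> u
    proof -
      let ?Xs = "map (\<lambda>F. F u) (Fs \<alpha> \<beta>)"
      \<comment> \<open>\<open>W \<alpha>\<close> is what remains of the derivative of
        \<open>X \<alpha>\<close> after removing its bracket with \<open>B \<gamma>\<close>. The
        slots holding \<open>M\<close> have remainder zero.\<close>
      define W where "W \<alpha> = (\<Sum>\<delta>\<in>UNIV. G \<delta> \<alpha> \<gamma> u *\<^sub>R X \<delta> u)" for \<alpha>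
      have inv: "(\<Sum>i<length (Fs \<alpha> \<beta>). g (?Xs[i := bracket (B \<gamma> u) (?Xs ! i)])) = 0"
      proof -
        \<comment> \<open>Closure of \<open>\<gg>\<close> under brackets keeps the modified lists
          inside \<open>\<gg>\<close>, so invariance of \<open>f\<close> transfers to
          \<open>g\<close>.\<close>
        have "g (?Xs[i := bracket (B \<gamma> u) (?Xs ! i)]) = f (?Xs[i := bracket (B \<gamma> u) (?Xs ! i)])"
          if "i < p" for i
        proof (rule g(2))
          have "?Xs ! i \<in> \<gg>"
            using Fs_mem[OF u, of \<alpha> \<beta>] that len[of \<alpha> \<beta>] by (metis length_map nth_mem subsetD)
          then have "bracket (B \<gamma> u) (?Xs ! i) \<in> \<gg>"
            using lie mem(2)[OF u] by (simp add: matrix_lie_algebra_def)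
          then show "set (?Xs[i := bracket (B \<gamma> u) (?Xs ! i)]) \<subseteq> \<gg>"
            using Fs_mem[OF u, of \<alpha> \<beta>] by (meson insert_subset order_trans set_update_subset_insert)
        qed (simp add: len)
        moreover have "(\<Sum>i<p. f (?Xs[i := bracket (B \<gamma> u) (?Xs ! i)])) = 0"
          using ad[unfolded ad_invariant_def, rule_format, OF mem(2)[OF u], of ?Xs] Fs_mem[OF u] len by simp
        ultimately show ?thesis by (simp add: len)
      qed
      have "partial_deriv \<gamma> (h \<alpha> \<beta>) u = partial_deriv \<gamma> (\<lambda>u. g (map (\<lambda>F. F u) (Fs \<alpha> \<beta>))) u"
        by (rule partial_deriv_cong[OF \<Omega> u h_eq])
      also have "\<dots> = (\<Sum>i<length (Fs \<alpha> \<beta>). g (?Xs[i := (W \<alpha> # W \<beta> # replicate q 0) ! i]))"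
      proof (rule partial_deriv_invariant_form[OF _ Fs_smooth u inv])
        show "partial_deriv \<gamma> (Fs \<alpha> \<beta> ! i) u = (W \<alpha> # W \<beta> # replicate q 0) ! i + bracket (B \<gamma> u) ((Fs \<alpha> \<beta> ! i) u)"
          if "i < length (Fs \<alpha> \<beta>)" for i
          using that lax_partial_deriv_bracket_M[OF \<Omega> lax u, of \<gamma>] lax_partial_deriv_M(1)[OF lax u, of \<gamma>]
          unfolding X_def[symmetric]
          by (auto simp: Fs_def W_def nth_Cons split: nat.splits) (auto simp: X_def)
      qed (simp_all add: len g(1), simp add: p)
      also have "\<dots> = g (?Xs[0 := W \<alpha>]) + g (?Xs[1 := W \<beta>])"
      proof -
        \<comment> \<open>Linearity over the empty index set: a zero entry annihilates the form, so
          only the first two slots survive.\<close>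
        have "g (?Xs[Suc (Suc i) := 0]) = 0" if "i < q" for i
          using multilinear_sum_scaleR[OF g(1), of ?Xs "Suc (Suc i)" _ _ "{}"] that by (simp add: len p)
        then show ?thesis
          by (simp add: len p sum.lessThan_Suc_shift del: sum.lessThan_Suc)
      qed
      also have "\<dots> = (\<Sum>\<delta>\<in>UNIV. G \<delta> \<alpha> \<gamma> u *\<^sub>R g (?Xs[0 := X \<delta> u]) + G \<delta> \<beta> \<gamma> u *\<^sub>R g (?Xs[1 := X \<delta> u]))"
        unfolding W_def sum.distrib using len
        by (simp add: multilinear_sum_scaleR[OF g(1)] p)
      finally show ?thesis
        by (simp add: h_eq[OF u] Fs_map)
    qed
  qed
  then show ?thesis
    by (simp add: h_def X_def p Let_def)
qed

end
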